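(* The variety of SLS-algebras over a field $\Bbbk$ is the smallest variety containing the class of all special left-symmetric algebras over $\Bbbk$.
   Context: $\Bbbk$ is an arbitrary field. Varieties here are classes of algebras over $\Bbbk$ with one bilinear operation $\circ$ defined by identities. A left-symmetric algebra is a linear space with a bilinear operation $\circ$ satisfying $(a,b,c)=(b,a,c)$, where $(a,b,c)=(a\circ b)\circ c-a\circ(b\circ c)$. An SLS-algebra is a left-symmetric algebra satisfying in addition the identities $((x\circ y)\circ z)\circ u=((x\circ z)\circ y)\circ u$ and $(x,y\circ z,u)=(y,x\circ z,u)$. A Perm-algebra is an associative (not necessarily unital) algebra satisfying $xyz=yxz$. A differential Perm-algebra is a pair $(P,d)$ with $P$ a Perm-algebra and $d$ a derivation of $P$. A left-symmetric algebra $(A,\circ)$ is special if it can be embedded into a differential Perm-algebra $(P,d)$ so that $a\circ b=a\,d(b)$, i.e., there is an injective linear map $\theta:A\to P$ with $\theta(a\circ b)=\theta(a)d(\theta(b))$ for all $a,b\in A$. *)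

theory Defs
  imports "HOL-Algebra.Module" "HOL-Library.Equipollence"
begin

(* An algebra over K is a K-module whose field mult is the bilinear product; the field one of the
   record carries no meaning.  All algebras considered have their carrier inside one type 'u, which
   plays the role of the universe. *)

definition linear_on ::
    "('k, 'm) ring_scheme \<Rightarrow> ('k, 'u) module \<Rightarrow> ('k, 'v) module \<Rightarrow> ('u \<Rightarrow> 'v) \<Rightarrow> bool" where
  "linear_on K A B f \<longleftrightarrow>
     f \<in> carrier A \<rightarrow> carrier B \<and>
     (\<forall>x\<in>carrier A. \<forall>y\<in>carrier A. f (x \<oplus>\<^bsub>A\<^esub> y) = f x \<oplus>\<^bsub>B\<^esub> f y) \<and>
     (\<forall>c\<in>carrier K. \<forall>x\<in>carrier A. f (c \<odot>\<^bsub>A\<^esub> x) = c \<odot>\<^bsub>B\<^esub> f x)"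

definition nonassoc_algebra :: "('k, 'm) ring_scheme \<Rightarrow> ('k, 'u) module \<Rightarrow> bool" where
  "nonassoc_algebra K A \<longleftrightarrow>
     module K A \<and>
     (\<forall>x\<in>carrier A. linear_on K A A (\<lambda>y. x \<otimes>\<^bsub>A\<^esub> y)) \<and>
     (\<forall>y\<in>carrier A. linear_on K A A (\<lambda>x. x \<otimes>\<^bsub>A\<^esub> y))"

datatype (term_coeffs: 'k) alg_term =
    TVar nat
  | TZero
  | TAdd "'k alg_term" "'k alg_term"
  | TSmult 'k "'k alg_term"
  | TMult "'k alg_term" "'k alg_term"

primrec eval_term :: "('k, 'u) module \<Rightarrow> (nat \<Rightarrow> 'u) \<Rightarrow> 'k alg_term \<Rightarrow> 'u" where
  "eval_term A v (TVar i) = v i"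
| "eval_term A v TZero = \<zero>\<^bsub>A\<^esub>"
| "eval_term A v (TAdd s t) = eval_term A v s \<oplus>\<^bsub>A\<^esub> eval_term A v t"
| "eval_term A v (TSmult c t) = c \<odot>\<^bsub>A\<^esub> eval_term A v t"
| "eval_term A v (TMult s t) = eval_term A v s \<otimes>\<^bsub>A\<^esub> eval_term A v t"

definition identities :: "('k, 'm) ring_scheme \<Rightarrow> ('k alg_term \<times> 'k alg_term) set" where
  "identities K = {(s, t). term_coeffs s \<subseteq> carrier K \<and> term_coeffs t \<subseteq> carrier K}"

definition satisfies :: "('k, 'u) module \<Rightarrow> 'k alg_term \<times> 'k alg_term \<Rightarrow> bool" where
  "satisfies A e \<longleftrightarrow> (\<forall>v. range v \<subseteq> carrier A \<longrightarrow> eval_term A v (fst e) = eval_term A v (snd e))"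

definition variety ::
    "('k, 'm) ring_scheme \<Rightarrow> ('k alg_term \<times> 'k alg_term) set \<Rightarrow> ('k, 'u) module set" where
  "variety K E = {A. nonassoc_algebra K A \<and> (\<forall>e\<in>E. satisfies A e)}"

definition is_variety :: "('k, 'm) ring_scheme \<Rightarrow> ('k, 'u) module set \<Rightarrow> bool" where
  "is_variety K V \<longleftrightarrow> (\<exists>E \<subseteq> identities K. V = variety K E)"

definition associator :: "('k, 'u) module \<Rightarrow> 'u \<Rightarrow> 'u \<Rightarrow> 'u \<Rightarrow> 'u" where
  "associator A a b c = ((a \<otimes>\<^bsub>A\<^esub> b) \<otimes>\<^bsub>A\<^esub> c) \<ominus>\<^bsub>A\<^esub> (a \<otimes>\<^bsub>A\<^esub> (b \<otimes>\<^bsub>A\<^esub> c))"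

definition left_symmetric_algebra :: "('k, 'm) ring_scheme \<Rightarrow> ('k, 'u) module \<Rightarrow> bool" where
  "left_symmetric_algebra K A \<longleftrightarrow>
     nonassoc_algebra K A \<and>
     (\<forall>a\<in>carrier A. \<forall>b\<in>carrier A. \<forall>c\<in>carrier A. associator A a b c = associator A b a c)"

definition SLS_algebra :: "('k, 'm) ring_scheme \<Rightarrow> ('k, 'u) module \<Rightarrow> bool" where
  "SLS_algebra K A \<longleftrightarrow>
     left_symmetric_algebra K A \<and>
     (\<forall>x\<in>carrier A. \<forall>y\<in>carrier A. \<forall>z\<in>carrier A. \<forall>u\<in>carrier A.
        ((x \<otimes>\<^bsub>A\<^esub> y) \<otimes>\<^bsub>A\<^esub> z) \<otimes>\<^bsub>A\<^esub> u = ((x \<otimes>\<^bsub>A\<^esub> z) \<otimes>\<^bsub>A\<^esub> y) \<otimes>\<^bsub>A\<^esub> u) \<and>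
     (\<forall>x\<in>carrier A. \<forall>y\<in>carrier A. \<forall>z\<in>carrier A. \<forall>u\<in>carrier A.
        associator A x (y \<otimes>\<^bsub>A\<^esub> z) u = associator A y (x \<otimes>\<^bsub>A\<^esub> z) u)"

definition Perm_algebra :: "('k, 'm) ring_scheme \<Rightarrow> ('k, 'u) module \<Rightarrow> bool" where
  "Perm_algebra K P \<longleftrightarrow>
     nonassoc_algebra K P \<and>
     (\<forall>x\<in>carrier P. \<forall>y\<in>carrier P. \<forall>z\<in>carrier P.
        (x \<otimes>\<^bsub>P\<^esub> y) \<otimes>\<^bsub>P\<^esub> z = x \<otimes>\<^bsub>P\<^esub> (y \<otimes>\<^bsub>P\<^esub> z)) \<and>
     (\<forall>x\<in>carrier P. \<forall>y\<in>carrier P. \<forall>z\<in>carrier P.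
        (x \<otimes>\<^bsub>P\<^esub> y) \<otimes>\<^bsub>P\<^esub> z = (y \<otimes>\<^bsub>P\<^esub> x) \<otimes>\<^bsub>P\<^esub> z)"

definition derivation :: "('k, 'm) ring_scheme \<Rightarrow> ('k, 'u) module \<Rightarrow> ('u \<Rightarrow> 'u) \<Rightarrow> bool" where
  "derivation K P d \<longleftrightarrow>
     linear_on K P P d \<and>
     (\<forall>x\<in>carrier P. \<forall>y\<in>carrier P. d (x \<otimes>\<^bsub>P\<^esub> y) = (d x \<otimes>\<^bsub>P\<^esub> y) \<oplus>\<^bsub>P\<^esub> (x \<otimes>\<^bsub>P\<^esub> d y))"

definition differential_Perm_algebra ::
    "('k, 'm) ring_scheme \<Rightarrow> ('k, 'u) module \<Rightarrow> ('u \<Rightarrow> 'u) \<Rightarrow> bool" where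
  "differential_Perm_algebra K P d \<longleftrightarrow> Perm_algebra K P \<and> derivation K P d"

(* P ranges over the same universe as A.  This is no restriction when the universe is infinite and
   at least as large as K: replace P by the d-closed subalgebra generated by the image of A. *)

definition special :: "('k, 'm) ring_scheme \<Rightarrow> ('k, 'u) module \<Rightarrow> bool" where
  "special K A \<longleftrightarrow>
     left_symmetric_algebra K A \<and>
     (\<exists>(P :: ('k, 'u) module) d \<theta>.
        differential_Perm_algebra K P d \<and>
        linear_on K A P \<theta> \<and> inj_on \<theta> (carrier A) \<and>
        (\<forall>a\<in>carrier A. \<forall>b\<in>carrier A. \<theta> (a \<otimes>\<^bsub>A\<^esub> b) = \<theta> a \<otimes>\<^bsub>P\<^esub> d (\<theta> b)))"

definition SLS_algebras :: "('k, 'm) ring_scheme \<Rightarrow> ('k, 'u) module set" where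
  "SLS_algebras K = {A. SLS_algebra K A}"

definition special_algebras :: "('k, 'm) ring_scheme \<Rightarrow> ('k, 'u) module set" where
  "special_algebras K = {A. special K A}"

definition smallest_variety_containing ::
    "('k, 'm) ring_scheme \<Rightarrow> ('k, 'u) module set \<Rightarrow> ('k, 'u) module set \<Rightarrow> bool" where
  "smallest_variety_containing K C V \<longleftrightarrow>
     is_variety K V \<and> C \<subseteq> V \<and> (\<forall>W. is_variety K W \<and> C \<subseteq> W \<longrightarrow> V \<subseteq> W)"

end

theory Submission
  imports Defs "HOL-Library.Multiset" "HOL-Library.Countable" "HOL-Algebra.Free_Abelian_Groups"
begin

text \<open>
  An identity valid in all special algebras holds in the free differential Perm-algebra \<open>F\<close> with
  product \<open>a d(b)\<close>.  To transfer it to an SLS-algebra \<open>A\<close> with chosen elements \<open>v i\<close>, one sends the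
  monomials of \<open>F\<close> generated by the variables to \<open>A\<close> multiplicatively.  Every
  left-symmetric algebra carries symmetric braces, modelled on
  \<open>(a\<^sub>1, \<dots>, a\<^sub>k; c) \<mapsto> a\<^sub>1 \<cdots> a\<^sub>k d\<^sup>k(c)\<close>, and iterated braces are indexed by rooted trees: the number of
  children of a vertex is the order of the derivative of its letter, and the root is the last
  letter of the monomial.  The two extra SLS identities say precisely that the value of a tree
  depends only on its root and on the multiset of the other vertices with their arities, that is,
  on a monomial of \<open>F\<close>.  All coefficients involved are \<open>\<plusminus>1\<close>, so the
  argument works in SLS rings and is characteristic free.
\<close>

section \<open>Braces in left-symmetric and SLS rings\<close>

text \<open>The recursion behind braces is the Leibniz rule: \<open>a \<star> brace c M\<close>
  models a d(a1 ... ak d^k(c)). Its expansion consists of the term in which d hits c, which is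
  \<open>brace c (add_mset a M)\<close>, and of the terms in which some \<open>ai\<close> becomes a
  d(ai), that is \<open>a \<star> ai\<close>. Solving for the first term defines it without any
  division.

  The algebraic obstacle is that A carries no derivation, so a monomial gets a value only through
  some tree with the prescribed arities. The shape of the tree, the order in which vertices are
  attached and the distribution of the leaves are arbitrary, and each choice has to be shown
  irrelevant before products can be computed. Once the value is multiplicative on proper monomials,
  evaluating a term in A factors through evaluating it at the generators of F, so an equality in F
  is pushed forward to A.

  The second obstacle is set-theoretic: the algebras of a variety live on the type
  \<open>'u\<close>, while F consists of functions on monomials. F is copied into \<open>'u\<close>
  along an injection, which the cardinality assumptions provide.\<close>

locale sls_ring =
  fixes mul :: "'a::ab_group_add \<Rightarrow> 'a \<Rightarrow> 'a"  (infixl "\<star>" 70)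
  assumes add_mul: "(x + y) \<star> z = x \<star> z + y \<star> z"
    and mul_add: "x \<star> (y + z) = x \<star> y + x \<star> z"
    and left_symmetric: "(x \<star> y) \<star> z + y \<star> (x \<star> z) = (y \<star> x) \<star> z + x \<star> (y \<star> z)"
    and right_commute: "((x \<star> y) \<star> z) \<star> u = ((x \<star> z) \<star> y) \<star> u"
    and exchange: "(x \<star> (y \<star> z)) \<star> u + y \<star> ((x \<star> z) \<star> u)
                 = (y \<star> (x \<star> z)) \<star> u + x \<star> ((y \<star> z) \<star> u)"
begin

lemma mul_zero [simp]: "x \<star> 0 = 0"
  using mul_add[of x 0 0] by simp

lemma zero_mul [simp]: "0 \<star> x = 0"
  using add_mul[of 0 0 x] by simp

lemma mul_minus: "x \<star> (- y) = - (x \<star> y)"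
  using mul_add[of x y "- y"] by (simp add: eq_neg_iff_add_eq_0 add.commute)

lemma minus_mul: "(- x) \<star> y = - (x \<star> y)"
  using add_mul[of x "- x" y] by (simp add: eq_neg_iff_add_eq_0 add.commute)

lemma mul_diff: "x \<star> (y - z) = x \<star> y - x \<star> z"
  using mul_add[of x y "- z"] by (simp add: mul_minus)

lemma diff_mul: "(x - y) \<star> z = x \<star> z - y \<star> z"
  using add_mul[of x "- y" z] by (simp add: minus_mul)

lemmas mul_algebra = add_mul mul_add mul_diff diff_mul

text \<open>\<open>a\<close> acts as a derivation: each entry \<open>b\<close> in turn becomes
  \<open>a \<star> b\<close>, as when a d( ) is applied to the product of the entries.\<close>

definition ds :: "'a \<Rightarrow> ('a multiset \<Rightarrow> 'a) \<Rightarrow> 'a multiset \<Rightarrow> 'a" where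
  "ds a f M = (\<Sum>b\<in>#M. f (add_mset (a \<star> b) (M - {#b#})))"

lemma ds_empty [simp]: "ds a f {#} = 0"
  by (simp add: ds_def)

lemma ds_add_mset:
  "ds a f (add_mset x M) = f (add_mset (a \<star> x) M) + ds a (\<lambda>N. f (add_mset x N)) M"
  by (auto simp: ds_def add_mset_commute intro!: arg_cong[where f = sum_mset] image_mset_cong)

lemma ds_cong2:
  assumes "\<And>p D. M = add_mset p D \<Longrightarrow> f (add_mset (a \<star> p) D) = g (add_mset (b \<star> p) D)"
  shows "ds a f M = ds b g M"
  unfolding ds_def
  by (rule arg_cong[where f = sum_mset], rule image_mset_cong) (metis assms insert_DiffM)

lemma ds_cong:
  assumes "\<And>N. size N = size M \<Longrightarrow> f N = g N"
  shows "ds a f M = ds a g M"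
  by (rule ds_cong2, rule assms) simp

lemma ds_plus: "ds a (\<lambda>N. f N + g N) M = ds a f M + ds a g M"
  by (simp add: ds_def sum_mset.distrib)

lemma ds_hom:
  assumes "\<And>x y. h (x + y) = h x + h y"
  shows "h (ds a f M) = ds a (\<lambda>N. h (f N)) M"
proof -
  have "h 0 = 0" using assms[of 0 0] by simp
  then have "h (\<Sum>b\<in>#B. F b) = (\<Sum>b\<in>#B. h (F b))" for B :: "'a multiset" and F
    by (induction B) (simp_all add: assms)
  then show ?thesis by (simp add: ds_def)
qed

lemma ds_diff: "ds a (\<lambda>N. f N - g N) M = ds a f M - ds a g M"
  using ds_plus[of a "\<lambda>N. f N - g N" g M] by simp

lemma mul_ds: "c \<star> ds a f M = ds a (\<lambda>N. c \<star> f N) M"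
  by (rule ds_hom) (rule mul_add)

lemma ds_mul: "ds a f M \<star> c = ds a (\<lambda>N. f N \<star> c) M"
  using ds_hom[of "\<lambda>x. x \<star> c"] by (simp add: add_mul)

text \<open>Additivity is recorded one size at a time: the induction in \<open>brace_aux\<close>
  knows it only below the current size, and later a function of leaves is controlled only at its own
  arity.\<close>

definition additive_at :: "nat \<Rightarrow> ('a multiset \<Rightarrow> 'a) \<Rightarrow> bool" where
  "additive_at n f \<longleftrightarrow>
     (\<forall>M x y. Suc (size M) = n \<longrightarrow> f (add_mset (x + y) M) = f (add_mset x M) + f (add_mset y M))"

lemma additive_atD:
  "additive_at n f \<Longrightarrow> Suc (size M) = n \<Longrightarrow> f (add_mset (x + y) M) = f (add_mset x M) + f (add_mset y M)"
  by (simp add: additive_at_def)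

lemma additive_at_diff:
  assumes "additive_at n f" "Suc (size M) = n"
  shows "f (add_mset (x - y) M) = f (add_mset x M) - f (add_mset y M)"
  using additive_atD[OF assms, of "x - y" y] by simp

lemma additive_at_add_mset:
  "additive_at (Suc n) f \<Longrightarrow> additive_at n (\<lambda>N. f (add_mset x N))"
  by (auto simp: additive_at_def add_mset_commute[of x])

lemma ds_left_add:
  assumes "additive_at (size M) f"
  shows "ds (x + y) f M = ds x f M + ds y f M"
proof -
  have "f (add_mset ((x + y) \<star> b) (M - {#b#})) =
      f (add_mset (x \<star> b) (M - {#b#})) + f (add_mset (y \<star> b) (M - {#b#}))" if "b \<in># M" for b
    using that by (simp add: add_mul additive_atD[OF assms] size_Suc_Diff1)
  then show ?thesis
    by (simp add: ds_def sum_mset.distrib[symmetric] cong: image_mset_cong)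
qed

text \<open>Left symmetry makes left multiplication a representation of the commutator bracket, and
  \<open>ds\<close> extends it by derivations; the order is reversed because the outer operator
  changes the argument first. Terms hitting two different entries agree on both sides, and those
  hitting one entry twice are \<open>left_symmetric\<close> inside \<open>f\<close>.\<close>

lemma ds_commutator:
  assumes "additive_at (size M) f"
  shows "ds a (ds b f) M + ds (a \<star> b) f M = ds b (ds a f) M + ds (b \<star> a) f M"
  using assms
proof (induction M arbitrary: f)
  case empty
  then show ?case by simp
next
  case (add x M)
  have fx: "additive_at (size M) (\<lambda>N. f (add_mset x N))"
    using add.prems by (simp add: additive_at_add_mset)
  have *: "ds a (ds b f) (add_mset x M) =
      f (add_mset (b \<star> (a \<star> x)) M) + ds b (\<lambda>N. f (add_mset (a \<star> x) N)) M
      + (ds a (\<lambda>N. f (add_mset (b \<star> x) N)) M + ds a (ds b (\<lambda>N. f (add_mset x N))) M)" for a b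
    by (simp add: ds_add_mset ds_plus)
  have **: "f (add_mset (b \<star> (a \<star> x)) M) + f (add_mset ((a \<star> b) \<star> x) M)
      = f (add_mset (a \<star> (b \<star> x)) M) + f (add_mset ((b \<star> a) \<star> x) M)"
    using additive_atD[OF add.prems, of M] left_symmetric[of a b x]
    by (metis add.commute size_add_mset)
  show ?case
    using add.IH[OF fx] ** unfolding * by (simp add: ds_add_mset algebra_simps)
qed

text \<open>The symmetric brace \<open>brace c {#a\<^sub>1, \<dots>, a\<^sub>k#}\<close> models \<open>a\<^sub>1 \<cdots> a\<^sub>k d\<^sup>k(c)\<close>.  The choice of the
  element split off first does not matter; this is the content of \<open>brace_add_mset\<close>.\<close>
primrec brace_n :: "nat \<Rightarrow> 'a \<Rightarrow> 'a multiset \<Rightarrow> 'a" where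
  "brace_n 0 c M = c"
| "brace_n (Suc n) c M =
     (let a = SOME a. a \<in># M in a \<star> brace_n n c (M - {#a#}) - ds a (brace_n n c) (M - {#a#}))"

definition brace :: "'a \<Rightarrow> 'a multiset \<Rightarrow> 'a" where
  "brace c M = brace_n (size M) c M"

lemma brace_empty [simp]: "brace c {#} = c"
  by (simp add: brace_def)

text \<open>The two claims support each other: independence of the element split off uses
  \<open>ds_commutator\<close>, which asks for additivity at a smaller size, and additivity at
  \<open>Suc n\<close> follows from the recursion at \<open>n\<close>.\<close>

lemma brace_aux:
  "(\<forall>a M. size M = n \<longrightarrow> brace c (add_mset a M) = a \<star> brace c M - ds a (brace c) M)
   \<and> additive_at (Suc n) (brace c)"
proof (induction n rule: less_induct)
  case (less n)
  \<comment> \<open>This is the second claim for \<open>n - 1\<close>; for \<open>n = 0\<close> it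
    is vacuous.\<close>
  have add_n: "additive_at n (brace c)"
    using less.IH[of "n - 1"] by (cases n) (auto simp: additive_at_def)
  define G where "G a M = a \<star> brace c M - ds a (brace c) M" for a M
  \<comment> \<open>The mixed terms are symmetric in \<open>a\<close> and \<open>b\<close>; what
    remains is left symmetry at \<open>brace c M\<close> together with
    \<open>ds_commutator\<close>.\<close>
  have sym: "G a (add_mset b M) = G b (add_mset a M)" if n: "n = Suc (size M)" for a b M
  proof -
    have eq: "brace c (add_mset b N) = b \<star> brace c N - ds b (brace c) N" if "size N = size M" for b N
      using less.IH[of "size M"] n that by simp
    have add_M: "additive_at (size M) (brace c)"
      using less.IH[of "size M - 1"] n by (cases M) (auto simp: additive_at_def)
    have "ds a (\<lambda>N. brace c (add_mset b N)) M = ds a (\<lambda>N. b \<star> brace c N - ds b (brace c) N) M" for a b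
      by (rule ds_cong) (rule eq)
    then have *: "G a (add_mset b M) = a \<star> (b \<star> brace c M) - a \<star> ds b (brace c) M
       - ((a \<star> b) \<star> brace c M - ds (a \<star> b) (brace c) M)
       - (b \<star> ds a (brace c) M - ds a (ds b (brace c)) M)" for a b
      unfolding G_def by (simp add: eq ds_add_mset ds_diff mul_ds mul_diff)
    show ?thesis
      unfolding * using ds_commutator[OF add_M, of a b] left_symmetric[of a b "brace c M"]
      by (simp add: algebra_simps)
  qed
  have eq: "brace c (add_mset a M) = a \<star> brace c M - ds a (brace c) M" if "size M = n" for a M
  proof -
    define a0 where "a0 = (SOME x. x \<in># add_mset a M)"
    have a0: "a0 \<in># add_mset a M"
      unfolding a0_def by (rule someI[of _ a]) simp
    let ?M = "add_mset a M - {#a0#}"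
    have sz: "size ?M = n"
      using a0 that by (simp add: size_Diff_singleton)
    have "brace c (add_mset a M) = a0 \<star> brace_n n c ?M - ds a0 (brace_n n c) ?M"
      by (simp only: brace_def size_add_mset brace_n.simps Let_def a0_def that)
    also have "ds a0 (brace_n n c) ?M = ds a0 (brace c) ?M"
      by (rule ds_cong) (simp add: brace_def sz)
    also have "a0 \<star> brace_n n c ?M - ds a0 (brace c) ?M = G a0 ?M"
      by (simp add: G_def brace_def sz)
    also have "G a0 ?M = G a M"
    proof (cases "a0 = a")
      case False
      then have "a0 \<in># M" using a0 by simp
      then obtain M' where M': "M = add_mset a0 M'" by (metis insert_DiffM)
      with that have "n = Suc (size M')" by simp
      then show ?thesis using sym[of M' a a0] M' by simp
    qed simp
    finally show ?thesis by (simp add: G_def)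
  qed
  moreover have "ds (x + y) (brace c) M = ds x (brace c) M + ds y (brace c) M" if "size M = n" for x y M
    using add_n that by (intro ds_left_add) simp
  then have "additive_at (Suc n) (brace c)"
    using eq by (auto simp: additive_at_def mul_algebra)
  ultimately show ?case by blast
qed

lemma brace_add_mset: "brace c (add_mset a M) = a \<star> brace c M - ds a (brace c) M"
  using brace_aux by blast

lemma mul_brace: "a \<star> brace c M = brace c (add_mset a M) + ds a (brace c) M"
  by (simp add: brace_add_mset)

lemma additive_brace: "additive_at n (brace c)"
  using brace_aux[of "n - 1" c] by (cases n) (auto simp: additive_at_def)

lemma brace_add: "brace c (add_mset (x + y) M) = brace c (add_mset x M) + brace c (add_mset y M)"
  using additive_atD[OF additive_brace] by blast

lemma brace_diff: "brace c (add_mset (x - y) M) = brace c (add_mset x M) - brace c (add_mset y M)"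
  using additive_at_diff[OF additive_brace] by blast

lemma brace_ds: "brace c (add_mset (ds a f N) M) = ds a (\<lambda>N. brace c (add_mset (f N) M)) N"
  by (rule ds_hom) (rule brace_add)

lemma brace_single [simp]: "brace c {#a#} = a \<star> c"
  by (simp add: brace_add_mset)

text \<open>In the differential model a left factor is followed by further letters, so its last
  letter commutes with the others: the relation models equality of monomials up to the choice of the
  marked letter.\<close>

definition same_mul (infix "\<sim>" 50) where
  "x \<sim> y \<longleftrightarrow> (\<forall>u. x \<star> u = y \<star> u)"

text \<open>By left symmetry \<open>(d \<star> x) \<star> u = d \<star> (x \<star> u) + (x \<star>
  d) \<star> u - x \<star> (d \<star> u)\<close>, and on the right \<open>x\<close> occurs only as a
  left factor.\<close>

lemma same_mul_left:
  assumes "x \<sim> y"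
  shows "d \<star> x \<sim> d \<star> y"
proof -
  have *: "x \<star> u = y \<star> u" for u using assms by (simp add: same_mul_def)
  have "(d \<star> x) \<star> u + y \<star> (d \<star> u) = (d \<star> y) \<star> u + y \<star> (d \<star> u)" for u
    using left_symmetric[of d x u] left_symmetric[of d y u] by (simp add: *)
  then show ?thesis by (simp add: same_mul_def)
qed

lemma brace_same_mul:
  assumes "x \<sim> y"
  shows "brace c (add_mset x M) = brace c (add_mset y M)"
proof -
  have *: "x \<star> u = y \<star> u" for u using assms by (simp add: same_mul_def)
  show ?thesis by (simp add: brace_add_mset * ds_cong2[of M "brace c" x "brace c" y])
qed

text \<open>Both sides model b d(c) D d^k(z) d(u). For empty \<open>D\<close> this is
  \<open>right_commute\<close>; in the step an entry \<open>d\<close> is split off and moved past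
  \<open>c\<close> by left symmetry.\<close>

lemma brace_mul_right: "(brace z (add_mset b D) \<star> c) \<star> u = brace z (add_mset (b \<star> c) D) \<star> u"
proof (induction "size D" arbitrary: D b c u)
  case 0
  then show ?case by (simp add: right_commute[of b])
next
  case (Suc n)
  then obtain d D' where D: "D = add_mset d D'" and n: "n = size D'"
    by (metis size_eq_Suc_imp_eq_union size_add_mset nat.inject)
  let ?T = "brace z (add_mset b D')"
  have IH: "(brace z (add_mset b N) \<star> c) \<star> u = brace z (add_mset (b \<star> c) N) \<star> u"
    if "size N = size D'" for N b c u
    using Suc.hyps(1)[of N] n that by simp
  have IH': "ds d (\<lambda>N. (brace z (add_mset b N) \<star> c) \<star> u) D' = ds d (\<lambda>N. brace z (add_mset (b \<star> c) N) \<star> u) D'"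
    by (rule ds_cong) (rule IH)
  note mm = same_mul_left[unfolded same_mul_def[of "_ \<star> _"], rule_format]
  have "(d \<star> ?T) \<star> c = d \<star> (?T \<star> c) + (?T \<star> d) \<star> c - ?T \<star> (d \<star> c)"
    using left_symmetric[of d ?T c] by (simp add: eq_diff_eq add.commute)
  then have "((d \<star> ?T) \<star> c) \<star> u = (d \<star> (?T \<star> c) + (?T \<star> d) \<star> c - ?T \<star> (d \<star> c)) \<star> u"
    by simp
  also have "\<dots> = (d \<star> brace z (add_mset (b \<star> c) D')) \<star> u + ((?T \<star> d) \<star> c) \<star> u - (?T \<star> (d \<star> c)) \<star> u"
    using mm[of "?T \<star> c" "brace z (add_mset (b \<star> c) D')"] IH
    by (simp add: same_mul_def mul_algebra)
  also have "((?T \<star> d) \<star> c) \<star> u = brace z (add_mset ((b \<star> d) \<star> c) D') \<star> u"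
    using IH by (metis)
  finally have "((d \<star> ?T) \<star> c) \<star> u - (brace z (add_mset (d \<star> b) D') \<star> c) \<star> u
     = (d \<star> brace z (add_mset (b \<star> c) D')) \<star> u - brace z (add_mset (d \<star> (b \<star> c)) D') \<star> u
       + brace z (add_mset ((b \<star> d) \<star> c + d \<star> (b \<star> c) - (b \<star> (d \<star> c) + (d \<star> b) \<star> c)) D') \<star> u"
    by (simp add: IH brace_add brace_diff mul_algebra)
  \<comment> \<open>What remains after the induction hypothesis collects into a single entry of the
    brace, and left symmetry makes it zero.\<close>
  also have "(b \<star> d) \<star> c + d \<star> (b \<star> c) - (b \<star> (d \<star> c) + (d \<star> b) \<star> c) = 0"
    using left_symmetric[of b d c] by (simp add: algebra_simps)
  also have "brace z (add_mset 0 D') = 0" using brace_add[of z 0 0 D'] by simp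
  finally show ?case
    unfolding D
    by (simp add: add_mset_commute[of _ d] brace_add_mset[of z d] ds_add_mset mul_algebra ds_mul IH'
        diff_diff_eq[symmetric])
qed

text \<open>The trees have the same vertices and arities, but parent \<open>z\<close> and child
  \<open>w\<close> trade places; the roots differ, hence \<open>\<sim>\<close> instead of equality.
  For empty \<open>C\<close> this is \<open>brace_mul_right\<close>; the step splits an entry off
  \<open>C\<close> and expands at both vertices.\<close>

lemma brace_swap_nodes:
  "brace z (add_mset (brace w (add_mset e C)) B) \<sim> brace w (add_mset (brace z (add_mset e B)) C)"
proof -
  have "brace z (add_mset (brace w (add_mset e C)) B) \<star> u = brace w (add_mset (brace z (add_mset e B)) C) \<star> u" for u
  proof (induction "size C" arbitrary: C B e u)
    case 0
    then show ?case by (simp add: brace_mul_right)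
  next
    case (Suc n)
    then obtain c C' where C: "C = add_mset c C'" and n: "n = size C'"
      by (metis size_eq_Suc_imp_eq_union size_add_mset nat.inject)
    have IH: "brace z (add_mset (brace w (add_mset e N)) B) \<star> u = brace w (add_mset (brace z (add_mset e B)) N) \<star> u"
      if "size N = size C'" for N B e u
      using Suc.hyps(1)[of N] n that by simp
    let ?E = "brace w (add_mset e C')" and ?F = "brace z (add_mset e B)"
    note eqE = mul_brace[of c z "add_mset ?E B", unfolded ds_add_mset]
    note eqF = mul_brace[of c w "add_mset ?F C'", unfolded ds_add_mset]
    note mm = same_mul_left[unfolded same_mul_def[of "_ \<star> _"], rule_format]
    have 1: "ds c (\<lambda>N. brace z (add_mset (brace w (add_mset e N)) B) \<star> u) C'
        = ds c (\<lambda>N. brace w (add_mset ?F N) \<star> u) C'"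
      by (rule ds_cong) (rule IH)
    have 2: "ds c (\<lambda>N. brace z (add_mset ?E N) \<star> u) B = ds c (\<lambda>N. brace w (add_mset (brace z (add_mset e N)) C') \<star> u) B"
      by (rule ds_cong) (simp add: IH)
    have 3: "(c \<star> brace z (add_mset ?E B)) \<star> u = (c \<star> brace w (add_mset ?F C')) \<star> u"
      by (rule mm) (simp add: same_mul_def IH)
    have "brace z (add_mset (brace w (add_mset e (add_mset c C'))) B) \<star> u
       = brace z (add_mset (c \<star> ?E) B) \<star> u - brace z (add_mset (brace w (add_mset (c \<star> e) C')) B) \<star> u
         - ds c (\<lambda>N. brace z (add_mset (brace w (add_mset e N)) B) \<star> u) C'"
      by (simp add: add_mset_commute[of e c] brace_add_mset[of w c] ds_add_mset brace_diff brace_add brace_ds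
          mul_algebra ds_mul algebra_simps)
    also have "\<dots> = (c \<star> brace z (add_mset ?E B)) \<star> u - brace z (add_mset ?E (add_mset c B)) \<star> u
         - ds c (\<lambda>N. brace z (add_mset ?E N) \<star> u) B
         - brace z (add_mset (brace w (add_mset (c \<star> e) C')) B) \<star> u
         - ds c (\<lambda>N. brace z (add_mset (brace w (add_mset e N)) B) \<star> u) C'"
      using arg_cong[OF eqE, of "\<lambda>x. x \<star> u"] by (simp add: mul_algebra ds_mul algebra_simps add_mset_commute[of c])
    also have "\<dots> = (c \<star> brace w (add_mset ?F C')) \<star> u - brace w (add_mset (brace z (add_mset e (add_mset c B))) C') \<star> u
         - ds c (\<lambda>N. brace w (add_mset (brace z (add_mset e N)) C') \<star> u) B
         - brace w (add_mset (brace z (add_mset (c \<star> e) B)) C') \<star> u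
         - ds c (\<lambda>N. brace w (add_mset ?F N) \<star> u) C'"
      unfolding 1 2 3 by (simp add: IH)
    \<comment> \<open>The three terms between the first and the last are the Leibniz expansion of
      \<open>c \<star> ?F\<close>, read backwards.\<close>
    also have "\<dots> = (c \<star> brace w (add_mset ?F C')) \<star> u - brace w (add_mset (c \<star> ?F) C') \<star> u
         - ds c (\<lambda>N. brace w (add_mset ?F N) \<star> u) C'"
    proof -
      have "c \<star> ?F = brace z (add_mset e (add_mset c B)) + (brace z (add_mset (c \<star> e) B) + ds c (\<lambda>N. brace z (add_mset e N)) B)"
        by (simp add: mul_brace ds_add_mset add_mset_commute)
      then show ?thesis by (simp add: brace_add brace_ds mul_algebra ds_mul algebra_simps)
    qed
    also have "\<dots> = brace w (add_mset ?F (add_mset c C')) \<star> u"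
      using arg_cong[OF eqF, of "\<lambda>x. x \<star> u"] by (simp add: mul_algebra ds_mul algebra_simps add_mset_commute[of c])
    finally show ?case unfolding C .
  qed
  then show ?thesis by (simp add: same_mul_def)
qed

text \<open>For empty \<open>B\<close> this is the axiom \<open>exchange\<close>, rewritten through
  two-entry braces. Otherwise \<open>y\<close> is split off the inner brace; the correction terms
  match by the induction hypothesis, the case of empty \<open>B\<close> and
  \<open>brace_mul_right\<close>.\<close>

lemma brace_exchange2:
  "brace c {#x, brace z (add_mset y B)#} = brace c {#y, brace z (add_mset x B)#}"
proof (induction "size B" arbitrary: B x y rule: less_induct)
  case less
  have pair: "brace c {#x, w#} = x \<star> (w \<star> c) - (x \<star> w) \<star> c" for x w
    by (simp add: brace_add_mset ds_add_mset)
  have ex: "brace c {#x, y \<star> z#} = brace c {#y, x \<star> z#}" for x y z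
    using exchange[of x y z c] by (simp add: pair algebra_simps)
  show ?case
  proof (cases "B = {#}")
    case True
    then show ?thesis by (simp add: ex)
  next
    case False
    let ?f = "\<lambda>x N. brace c {#x, brace z N#}"
    have *: "?f y (add_mset (x \<star> p) D) = ?f x (add_mset (y \<star> p) D)" if "B = add_mset p D" for p D
    proof -
      have sim: "brace z (add_mset y D) \<star> p \<sim> brace z (add_mset (y \<star> p) D)"
        by (simp add: same_mul_def brace_mul_right)
      have "?f y (add_mset (x \<star> p) D) = ?f (x \<star> p) (add_mset y D)"
        using less[of D] that by simp
      also have "\<dots> = brace c {#brace z (add_mset y D), x \<star> p#}"
        by (simp add: add_mset_commute)
      also have "\<dots> = brace c {#x, brace z (add_mset y D) \<star> p#}" by (rule ex)
      also have "\<dots> = ?f x (add_mset (y \<star> p) D)"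
        using brace_same_mul[OF sim, of c "{#x#}"] by (simp add: add_mset_commute)
      finally show ?thesis .
    qed
    have "ds x (?f y) B = ds y (?f x) B"
      by (rule ds_cong2) (rule *)
    moreover have "?f x (add_mset y B) = brace c {#x, y \<star> brace z B#} - ds y (?f x) B" for x y
      using brace_diff[of c "y \<star> brace z B" "ds y (brace z) B" "{#x#}"] brace_ds[of c y "brace z" B "{#x#}"]
      by (simp add: brace_add_mset[of z] add_mset_commute)
    ultimately show ?thesis
      by (metis ex)
  qed
qed

text \<open>Further siblings \<open>P\<close> are added one at a time. The Leibniz expansion also
  puts the new entry below \<open>z\<close>, so \<open>B\<close> has to stay arbitrary in the
  induction.\<close>

lemma brace_exchange:
  "brace c (add_mset x (add_mset (brace z (add_mset y B)) P)) =
   brace c (add_mset y (add_mset (brace z (add_mset x B)) P))"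
proof (induction "size P" arbitrary: P x y B)
  case 0
  then show ?case by (simp add: brace_exchange2)
next
  case (Suc n)
  then obtain a P' where P: "P = add_mset a P'" and n: "n = size P'"
    by (metis size_eq_Suc_imp_eq_union size_add_mset nat.inject)
  let ?g = "\<lambda>x y B P. brace c (add_mset x (add_mset (brace z (add_mset y B)) P))"
  have IH: "?g x y B N = ?g y x B N" if "size N = size P'" for N x y B
    using Suc.hyps(1)[of N] n that by simp
  have *: "?g x y B (add_mset a P') = a \<star> ?g x y B P'
      - (?g (a \<star> x) y B P' + (?g x y (add_mset a B) P' + ?g x (a \<star> y) B P' + ds a (\<lambda>N. ?g x y N P') B)
         + ds a (?g x y B) P')" for x y
  proof -
    let ?W = "brace z (add_mset y B)"
    have "?g x y B (add_mset a P') = brace c (add_mset a (add_mset x (add_mset ?W P')))"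
      by (simp add: add_mset_commute)
    also have "\<dots> = a \<star> ?g x y B P' - (?g (a \<star> x) y B P' + (brace c (add_mset (a \<star> ?W) (add_mset x P'))
         + ds a (?g x y B) P'))"
      by (simp add: brace_add_mset[of c a] ds_add_mset add_mset_commute)
    also have "a \<star> ?W = brace z (add_mset y (add_mset a B)) + brace z (add_mset (a \<star> y) B) + ds a (\<lambda>N. brace z (add_mset y N)) B"
      by (simp add: mul_brace ds_add_mset add_mset_commute)
    also have "brace c (add_mset \<dots> (add_mset x P'))
        = ?g x y (add_mset a B) P' + ?g x (a \<star> y) B P' + ds a (\<lambda>N. ?g x y N P') B"
      by (simp add: brace_add brace_ds add_mset_commute[of x])
    finally show ?thesis by (simp add: add.assoc)
  qed
  have 1: "ds a (\<lambda>N. ?g x y N P') B = ds a (\<lambda>N. ?g y x N P') B"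
    by (rule ds_cong) (simp add: IH)
  have 2: "ds a (?g x y B) P' = ds a (?g y x B) P'"
    by (rule ds_cong) (simp add: IH)
  have 3: "?g x y (add_mset a B) P' = ?g y x (add_mset a B) P'" "?g x y B P' = ?g y x B P'"
    "?g (a \<star> x) y B P' = ?g y (a \<star> x) B P'" "?g x (a \<star> y) B P' = ?g (a \<star> y) x B P'"
    by (simp_all add: IH)
  show ?case unfolding P * 1 2 3 by (simp add: algebra_simps)
qed

end

section \<open>Grafting and caterpillars\<close>

lemma multiset_split:
  fixes M :: "'b multiset"
  assumes "size M = a + b"
  obtains A B where "M = A + B" "size A = a" "size B = b"
proof -
  obtain xs where xs: "mset xs = M" by (metis ex_mset)
  have "M = mset (take a xs) + mset (drop a xs)"
    by (metis xs append_take_drop_id mset_append)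
  moreover have "length xs = a + b" using xs assms by (metis size_mset)
  ultimately show ?thesis using that by simp
qed

context sls_ring
begin

lemma ds_union: "ds a f (Q + P) = ds a (\<lambda>N. f (N + P)) Q + ds a (\<lambda>N. f (Q + N)) P"
  by (induction Q arbitrary: f) (simp_all add: ds_add_mset add.assoc)

text \<open>\<open>S\<close> is thought of as a function of \<open>n\<close> interchangeable leaves.  The last clause says that two
  leaves may be exchanged even if one of them is attached to a further vertex \<open>z\<close>.\<close>
definition admissible :: "nat \<Rightarrow> ('a multiset \<Rightarrow> 'a) \<Rightarrow> bool" where
  "admissible n S \<longleftrightarrow> additive_at n S \<and>
     (\<forall>x y P. Suc (size P) = n \<longrightarrow> x \<sim> y \<longrightarrow> S (add_mset x P) = S (add_mset y P)) \<and>
     (\<forall>x y z B P. Suc (Suc (size P)) = n \<longrightarrow>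
        S (add_mset x (add_mset (brace z (add_mset y B)) P)) =
        S (add_mset y (add_mset (brace z (add_mset x B)) P)))"

lemma admissible_brace: "admissible n (brace c)"
  unfolding admissible_def
  by (intro conjI allI impI additive_brace brace_same_mul brace_exchange)

lemma admissible_add:
  "admissible n S \<Longrightarrow> Suc (size P) = n \<Longrightarrow> S (add_mset (x + y) P) = S (add_mset x P) + S (add_mset y P)"
  using additive_atD[of n S P x y] by (simp add: admissible_def)

lemma admissible_same_mul:
  "admissible n S \<Longrightarrow> Suc (size P) = n \<Longrightarrow> x \<sim> y \<Longrightarrow> S (add_mset x P) = S (add_mset y P)"
  by (simp add: admissible_def)

lemma admissible_exchange:
  "admissible n S \<Longrightarrow> Suc (Suc (size P)) = n \<Longrightarrow>
   S (add_mset x (add_mset (brace z (add_mset y B)) P)) = S (add_mset y (add_mset (brace z (add_mset x B)) P))"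
  by (simp add: admissible_def)

text \<open>Replaces one leaf of \<open>S\<close> by a vertex \<open>z\<close> with \<open>j\<close> leaves.  Which \<open>j\<close> elements are chosen is
  irrelevant when \<open>S\<close> is admissible of the matching arity (\<open>graft_eq\<close>).\<close>
definition graft :: "'a \<times> nat \<Rightarrow> ('a multiset \<Rightarrow> 'a) \<Rightarrow> 'a multiset \<Rightarrow> 'a" where
  "graft zj S M = (let Q = SOME Q. Q \<subseteq># M \<and> size Q = snd zj in S (add_mset (brace (fst zj) Q) (M - Q)))"

text \<open>The exchange clause of \<open>admissible\<close> trades one element of \<open>Q\<close>
  for one of \<open>P\<close>; repeated trades carry \<open>Q\<close> into \<open>Q'\<close>, each
  one shrinking \<open>Q - Q'\<close>.\<close>

lemma admissible_split_unique:
  assumes S: "admissible (Suc (size P)) S"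
    and "Q + P = Q' + P'" "size Q = size Q'"
  shows "S (add_mset (brace z Q) P) = S (add_mset (brace z Q') P')"
  using assms
proof (induction "size (Q - Q')" arbitrary: Q P rule: less_induct)
  case less
  show ?case
  proof (cases "Q - Q' = {#}")
    case True
    then have "Q \<subseteq># Q'" by (simp add: Diff_eq_empty_iff_mset)
    then have "Q = Q'" using less.prems(3)
      by (metis mset_subset_size nless_le subset_mset.less_le)
    then show ?thesis using less.prems(2) by simp
  next
    case False
    then obtain x where x: "x \<in># Q - Q'" by blast
    have "Q' - Q \<noteq> {#}"
    proof
      assume "Q' - Q = {#}"
      then have "Q' \<subseteq># Q" by (simp add: Diff_eq_empty_iff_mset)
      then have "Q = Q'" using less.prems(3) by (metis mset_subset_size nless_le subset_mset.less_le)
      with False show False by simp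
    qed
    then obtain y where y: "y \<in># Q' - Q" by blast
    have cx: "count Q' x < count Q x" and cy: "count Q y < count Q' y"
      using x y by (simp_all add: in_diff_count)
    have cnt: "count Q w + count P w = count Q' w + count P' w" for w
      using arg_cong[OF less.prems(2), of "\<lambda>M. count M w"] by simp
    have "0 < count P y" using cnt[of y] cy by linarith
    then have "y \<in># P" by simp
    then obtain P1 where P: "P = add_mset y P1" by (metis insert_DiffM)
    have "x \<in># Q" using cx by (simp flip: count_greater_zero_iff)
    then obtain Q1 where Q: "Q = add_mset x Q1" by (metis insert_DiffM)
    have "x \<noteq> y" using cx cy by auto
    have "Q - Q' = add_mset x (Q1 - Q')" "add_mset y Q1 - Q' = Q1 - Q'"
      using cx cy \<open>x \<noteq> y\<close> unfolding Q by (auto intro!: multiset_eqI)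
    then have "size (add_mset y Q1 - Q') < size (Q - Q')" by simp
    then have "S (add_mset (brace z (add_mset y Q1)) (add_mset x P1)) = S (add_mset (brace z Q') P')"
      using less.prems unfolding P Q by (intro less.hyps) (simp_all add: P Q add_mset_commute)
    moreover have "S (add_mset y (add_mset (brace z (add_mset x Q1)) P1)) = S (add_mset x (add_mset (brace z (add_mset y Q1)) P1))"
      using less.prems(1) P by (intro admissible_exchange) simp_all
    ultimately show ?thesis by (simp add: P Q add_mset_commute)
  qed
qed

lemma graft_SOME:
  assumes "j \<le> size M"
  defines "Q \<equiv> SOME Q. Q \<subseteq># M \<and> size Q = j"
  shows "Q \<subseteq># M" "size Q = j"
proof -
  obtain A B where "M = A + B" "size A = j"
    using assms(1) multiset_split[of M j "size M - j"] by auto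
  then have "A \<subseteq># M \<and> size A = j" by simp
  then have "Q \<subseteq># M \<and> size Q = j" unfolding Q_def by (rule someI)
  then show "Q \<subseteq># M" "size Q = j" by auto
qed

lemma graft_eq:
  assumes "admissible (Suc (size P)) S" "size Q = j"
  shows "graft (z, j) S (Q + P) = S (add_mset (brace z Q) P)"
proof -
  define Q' where "Q' = (SOME Q'. Q' \<subseteq># Q + P \<and> size Q' = j)"
  have "Q' \<subseteq># Q + P" "size Q' = j"
    unfolding Q'_def using assms graft_SOME[of j "Q + P"] by simp_all
  then have "S (add_mset (brace z Q) P) = S (add_mset (brace z Q') (Q + P - Q'))"
    using assms by (intro admissible_split_unique) (simp_all add: subset_mset.add_diff_inverse)
  then show ?thesis by (simp add: graft_def Let_def Q'_def)
qed

lemma graft_cong: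
  assumes "\<And>N. size N = Suc n \<Longrightarrow> S N = S' N" "size M = n + snd zj"
  shows "graft zj S M = graft zj S' M"
  using assms graft_SOME[of "snd zj" M] by (simp add: graft_def Let_def size_Diff_submset)

text \<open>This closure property lets grafting be iterated. Additivity and invariance under
  \<open>\<sim>\<close> are tested with the varied leaf placed below \<open>z\<close>; the work lies
  in the exchange clause.\<close>

lemma admissible_graft:
  assumes S: "admissible (Suc n) S" and j: "snd zj = Suc j"
  shows "admissible (Suc (n + j)) (graft zj S)"
proof -
  obtain z where zj: "zj = (z, Suc j)" using j by (metis prod.collapse)
  have eq: "graft zj S (add_mset x (Q + P)) = S (add_mset (brace z (add_mset x Q)) P)"
    if "size Q = j" "size P = n" for x Q P
    using graft_eq[of P S "add_mset x Q" "Suc j" z] that S by (simp add: zj)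
  show ?thesis
    unfolding admissible_def additive_at_def
  proof (intro conjI allI impI)
    fix x y :: 'a and M :: "'a multiset" assume "Suc (size M) = Suc (n + j)"
    then obtain Q P where *: "M = Q + P" "size Q = j" "size P = n"
      using multiset_split[of M j n] by auto
    show "graft zj S (add_mset (x + y) M) = graft zj S (add_mset x M) + graft zj S (add_mset y M)"
      using * S by (simp add: eq brace_add admissible_add)
    show "graft zj S (add_mset x M) = graft zj S (add_mset y M)" if "x \<sim> y"
      using * by (simp add: eq brace_same_mul[OF that])
  next
    fix x y w :: 'a and B M :: "'a multiset" assume "Suc (Suc (size M)) = Suc (n + j)"
    then have sz: "n + j = Suc (size M)" by simp
    show "graft zj S (add_mset x (add_mset (brace w (add_mset y B)) M)) =
       graft zj S (add_mset y (add_mset (brace w (add_mset x B)) M))"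
    proof (cases n)
      case 0
      \<comment> \<open>Here \<open>S\<close> has a single leaf, so everything hangs below
        \<open>z\<close> and \<open>brace_exchange\<close> applies.\<close>
      have "graft zj S (add_mset x (add_mset (brace w (add_mset y B)) M))
        = S {#brace z (add_mset x (add_mset (brace w (add_mset y B)) M))#}" for x y
        using eq[of "add_mset (brace w (add_mset y B)) M" "{#}" x] sz 0 by simp
      then show ?thesis using brace_exchange by simp
    next
      case (Suc n')
      then obtain Q P where *: "M = Q + P" "size Q = j" "size P = n'"
        using multiset_split[of M j n'] sz by auto
      \<comment> \<open>Hang the vertex \<open>w\<close> below \<open>z\<close> and swap the two,
        exchange \<open>x\<close> with the whole branch at \<open>z\<close>, then exchange
        \<open>y\<close> with the branch at \<open>w\<close> and swap again: \<open>x\<close> and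
        \<open>y\<close> have traded places.\<close>
      have sim: "brace z (add_mset (brace w (add_mset y B)) Q) \<sim> brace w (add_mset (brace z (add_mset y Q)) B)" for y
        by (rule brace_swap_nodes)
      have 1: "graft zj S (add_mset x (add_mset (brace w (add_mset y B)) M))
        = S (add_mset x (add_mset (brace w (add_mset (brace z (add_mset y Q)) B)) P))" for x y
        using eq[of Q "add_mset x P" "brace w (add_mset y B)"] * Suc S
         admissible_same_mul[OF S _ sim, of "add_mset x P" y]
        by (simp add: add_mset_commute)
      have 2: "S (add_mset x (add_mset (brace w (add_mset (brace z (add_mset y Q)) B)) P))
        = S (add_mset (brace z (add_mset y Q)) (add_mset (brace w (add_mset x B)) P))" for x y
        using S Suc * by (intro admissible_exchange) simp_all
      have 3: "S (add_mset (brace z (add_mset y Q)) (add_mset (brace w (add_mset x B)) P))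
        = S (add_mset y (add_mset (brace z (add_mset (brace w (add_mset x B)) Q)) P))" for x y
        using admissible_exchange[OF S, of P "brace w (add_mset x B)" z y Q] Suc *
        by (simp add: add_mset_commute)
      have 4: "S (add_mset y (add_mset (brace z (add_mset (brace w (add_mset x B)) Q)) P))
        = S (add_mset y (add_mset (brace w (add_mset (brace z (add_mset x Q)) B)) P))" for x y
        using admissible_same_mul[OF S _ sim, of "add_mset y P" x] Suc *
        by (simp add: add_mset_commute)
      show ?thesis
        using 1[of x y] 2[of x y] 3[of y x] 4[of y x] 1[of y x] by metis
    qed
  qed
qed

text \<open>The leaves are chosen so that both new vertices lie on one path ending at a common leaf
  \<open>e\<close>. The two orders then differ only in which vertex is the parent, and
  \<open>brace_swap_nodes\<close> applies.\<close>

lemma graft_commute: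
  assumes S: "admissible (Suc n) S" and "size M = Suc (n + i + j)"
  shows "graft (w, Suc i) (graft (z, Suc j) S) M = graft (z, Suc j) (graft (w, Suc i) S) M"
proof -
  obtain M' e where M': "M = add_mset e M'"
    using assms(2) size_eq_Suc_imp_eq_union by blast
  then have "size M' = i + (j + n)" using assms(2) by simp
  then obtain I M'' where I: "M' = I + M''" "size I = i" "size M'' = j + n"
    by (rule multiset_split)
  from I(3) obtain Q P where "M'' = Q + P" "size Q = j" "size P = n"
    by (rule multiset_split)
  with M' I have M: "M = add_mset e (I + (Q + P))" "size I = i" "size Q = j" "size P = n"
    by simp_all
  have *: "graft (w, Suc i) (graft (z, Suc j) S) (add_mset e (I + (Q + P)))
     = S (add_mset (brace z (add_mset (brace w (add_mset e I)) Q)) P)"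
    if "size I = i" "size Q = j" for w z I Q i j
  proof -
    have "graft (w, Suc i) (graft (z, Suc j) S) (add_mset e I + (Q + P))
       = graft (z, Suc j) S (add_mset (brace w (add_mset e I)) (Q + P))"
      using that M admissible_graft[OF S, of "(z, Suc j)" j] by (intro graft_eq) (simp_all add: add.commute)
    also have "\<dots> = graft (z, Suc j) S (add_mset (brace w (add_mset e I)) Q + P)"
      by simp
    also have "\<dots> = S (add_mset (brace z (add_mset (brace w (add_mset e I)) Q)) P)"
      using that M S by (intro graft_eq) simp_all
    finally show ?thesis by simp
  qed
  show ?thesis
    using *[of I i Q j w z] *[of Q j I i z w] admissible_same_mul[OF S _ brace_swap_nodes] M
    by (simp add: add.left_commute)
qed

text \<open>The head of the list takes its leaves first and its value becomes a leaf for the rest;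
  the last entry is attached directly to \<open>S\<close>.\<close>

definition grafts :: "('a \<times> nat) list \<Rightarrow> ('a multiset \<Rightarrow> 'a) \<Rightarrow> 'a multiset \<Rightarrow> 'a" where
  "grafts zs S = foldr graft zs S"

text \<open>Number of leaves gained by grafting; the truncated subtraction is harmless since it is only
  applied to lists without vertices of arity 0.\<close>
definition excess :: "('a \<times> nat) list \<Rightarrow> nat" where
  "excess zs = (\<Sum>zj\<leftarrow>zs. snd zj - 1)"

lemma grafts_simps [simp]:
  "grafts [] S = S" "grafts (zj # zs) S = graft zj (grafts zs S)"
  "grafts (zs @ ws) S = grafts zs (grafts ws S)"
  by (simp_all add: grafts_def)

lemma excess_simps [simp]:
  "excess [] = 0" "excess (zj # zs) = snd zj - 1 + excess zs" "excess (zs @ ws) = excess zs + excess ws"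
  by (simp_all add: excess_def)

text \<open>A vertex of arity \<open>j\<close> consumes one leaf and supplies \<open>j\<close>. The
  \<open>Suc\<close> keeps a leaf available at every stage.\<close>

lemma admissible_grafts:
  assumes "admissible (Suc n) S" "\<forall>zj\<in>set zs. snd zj \<noteq> 0"
  shows "admissible (Suc (n + excess zs)) (grafts zs S)"
  using assms(2)
proof (induction zs)
  case (Cons zj zs)
  then have "admissible (Suc (n + excess zs + (snd zj - 1))) (graft zj (grafts zs S))"
    by (intro admissible_graft) auto
  then show ?case by (simp add: ac_simps)
qed (use assms in simp)

lemma grafts_move:
  assumes "admissible (Suc n) S" "\<forall>zj\<in>set (xs @ a # ys). snd zj \<noteq> 0"
    "size M = Suc (n + excess (xs @ a # ys))"
  shows "grafts (xs @ a # ys) S M = grafts (a # xs @ ys) S M"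
  using assms
proof (induction xs arbitrary: M)
  case (Cons x xs)
  have "snd x \<noteq> 0" "snd a \<noteq> 0" using Cons.prems(2) by auto
  then obtain z j w i where xa: "x = (z, Suc j)" "a = (w, Suc i)"
    by (metis not0_implies_Suc prod.collapse)
  have "graft x (grafts (xs @ a # ys) S) M = graft x (grafts (a # xs @ ys) S) M"
    using Cons by (intro graft_cong[where n = "n + excess (xs @ a # ys)"]) auto
  also have "\<dots> = graft a (graft x (grafts (xs @ ys) S)) M"
    unfolding grafts_simps(2) xa using Cons.prems admissible_grafts[OF Cons.prems(1), of "xs @ ys"] xa
    by (intro graft_commute) (auto simp: ac_simps)
  finally show ?case by simp
qed simp

text \<open>Makes \<open>grafts\<close> a function of the multiset of vertices, so that the
  arbitrary ordering in \<open>graft_val\<close> is harmless.\<close>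

lemma grafts_perm:
  assumes "admissible (Suc n) S" "\<forall>zj\<in>set zs. snd zj \<noteq> 0" "mset zs = mset ws"
    "size M = Suc (n + excess zs)"
  shows "grafts zs S M = grafts ws S M"
  using assms
proof (induction zs arbitrary: ws M)
  case (Cons z zs)
  have "z \<in> set ws" using Cons.prems(3) by (metis list.set_intros(1) set_mset_mset)
  then obtain xs ys where ws: "ws = xs @ z # ys" by (metis split_list)
  have m: "mset zs = mset (xs @ ys)" using Cons.prems(3) ws by simp
  have st: "set (z # zs) = set ws" using Cons.prems(3) by (metis set_mset_mset)
  have ex: "excess zs = excess (xs @ ys)"
    by (simp only: excess_def sum_mset_sum_list[symmetric] mset_map m)
  have "graft z (grafts zs S) M = graft z (grafts (xs @ ys) S) M"
  proof (rule graft_cong[where n = "n + excess zs"])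
    show "grafts zs S N = grafts (xs @ ys) S N" if "size N = Suc (n + excess zs)" for N
      using Cons.prems(2) m that by (intro Cons.IH[OF Cons.prems(1)]) simp_all
    show "size M = n + excess zs + snd z"
      using Cons.prems(2,4) by simp
  qed
  also have "\<dots> = grafts ws S M"
    unfolding ws using Cons.prems st ex ws by (subst grafts_move[OF Cons.prems(1)]) auto
  finally show ?case by simp
qed simp

text \<open>Substituting the value of a whole tree for a leaf turns its root \<open>s\<close>, which
  receives \<open>h\<close> leaves after \<open>ws\<close> are grafted, into an ordinary vertex of
  arity \<open>h\<close>. In the model, the marked letter of a left factor becomes unmarked.\<close>

lemma graft_node:
  assumes S: "admissible (Suc (size P)) S" and nz: "\<forall>zj\<in>set ws. snd zj \<noteq> 0" and h: "h \<noteq> 0"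
    and "size L = h + excess ws"
  shows "S (add_mset (grafts ws (brace s) L) P) = grafts (ws @ [(s, h)]) S (L + P)"
  using assms(2,4)
proof (induction ws arbitrary: L)
  case Nil
  then show ?case using graft_eq[OF S, of L h s] by simp
next
  case (Cons zj ws)
  obtain z j where zj: "zj = (z, Suc j)"
    using Cons.prems(1) by (metis list.set_intros(1) not0_implies_Suc prod.collapse)
  obtain I R where L: "L = I + R" "size I = Suc j" "size R = h - 1 + excess ws"
    using multiset_split[of L "Suc j" "h - 1 + excess ws"] Cons.prems(2) zj h by auto
  have "grafts (zj # ws) (brace s) L = graft (z, Suc j) (grafts ws (brace s)) (I + R)"
    by (simp add: zj L)
  also have "\<dots> = grafts ws (brace s) (add_mset (brace z I) R)"
    using L Cons.prems admissible_grafts[OF admissible_brace, of ws "h - 1" s]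
    by (intro graft_eq) (auto simp: ac_simps)
  finally have "S (add_mset (grafts (zj # ws) (brace s) L) P)
      = grafts (ws @ [(s, h)]) S (add_mset (brace z I) R + P)"
    using Cons L h by simp
  also have "\<dots> = grafts (ws @ [(s, h)]) S (add_mset (brace z I) (R + P))" by simp
  also have "\<dots> = graft (z, Suc j) (grafts (ws @ [(s, h)]) S) (I + (R + P))"
    using L Cons.prems h admissible_grafts[OF S, of "ws @ [(s, h)]"]
    by (intro graft_eq[symmetric]) (auto simp: ac_simps)
  finally show ?case by (simp add: zj L add.assoc)
qed

primrec increments :: "('a \<times> nat) list \<Rightarrow> ('a \<times> nat) list list" where
  "increments [] = []"
| "increments (zj # zs) = ((fst zj, Suc (snd zj)) # zs) # map ((#) zj) (increments zs)"

lemma increments_nonzero: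
  "ws \<in> set (increments zs) \<Longrightarrow> \<forall>zj\<in>set zs. snd zj \<noteq> 0 \<Longrightarrow> \<forall>zj\<in>set ws. snd zj \<noteq> 0"
  by (induction zs arbitrary: ws) (force simp: image_iff)+

lemma increments_excess:
  "ws \<in> set (increments zs) \<Longrightarrow> \<forall>zj\<in>set zs. snd zj \<noteq> 0 \<Longrightarrow> excess ws = Suc (excess zs)"
  by (induction zs arbitrary: ws) auto

text \<open>Leibniz rule for \<open>b\<close> times a tree: the three summands are the cases in
  which \<open>b\<close> becomes a new child of the root, becomes a new child of another vertex, or
  acts on a leaf.\<close>

lemma mul_grafts:
  assumes "\<forall>zj\<in>set zs. snd zj \<noteq> 0" "size M = Suc (n + excess zs)"
  shows "b \<star> grafts zs (brace c) M =
    grafts zs (brace c) (add_mset b M) + (\<Sum>ws\<leftarrow>increments zs. grafts ws (brace c) (add_mset b M))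
    + ds b (grafts zs (brace c)) M"
  using assms
proof (induction zs arbitrary: M)
  case Nil
  then show ?case by (simp add: mul_brace)
next
  case (Cons zj zs)
  obtain z j where zj: "zj = (z, Suc j)"
    using Cons.prems(1) by (metis list.set_intros(1) not0_implies_Suc prod.collapse)
  let ?S = "grafts zs (brace c)"
  have nz: "\<forall>zj\<in>set zs. snd zj \<noteq> 0" using Cons.prems by simp
  obtain Q P where M: "M = Q + P" "size Q = Suc j" "size P = n + excess zs"
    using multiset_split[of M "Suc j" "n + excess zs"] Cons.prems(2) zj by auto
  have adm: "admissible (Suc (n + excess zs)) ?S" "admissible (Suc (Suc (n + excess zs))) ?S"
    using admissible_grafts[OF admissible_brace nz, of n c] admissible_grafts[OF admissible_brace nz, of "Suc n" c]
    by simp_all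
  have eq: "graft (z, Suc j) ?S (Q' + P') = ?S (add_mset (brace z Q') P')"
    if "size Q' = Suc j" "size P' = n + excess zs" for Q' P'
    using that adm by (intro graft_eq) simp_all
  have "b \<star> grafts (zj # zs) (brace c) M = b \<star> ?S (add_mset (brace z Q) P)"
    using eq M by (simp add: zj)
  also have "\<dots> = ?S (add_mset b (add_mset (brace z Q) P))
     + (\<Sum>ws\<leftarrow>increments zs. grafts ws (brace c) (add_mset b (add_mset (brace z Q) P)))
     + ds b ?S (add_mset (brace z Q) P)"
    using Cons.IH[of "add_mset (brace z Q) P"] nz M by simp
  also have "?S (add_mset b (add_mset (brace z Q) P)) = graft (z, Suc j) ?S (Q + add_mset b P)"
    using adm M by (subst graft_eq) (simp_all add: add_mset_commute)
  also have "map (\<lambda>ws. grafts ws (brace c) (add_mset b (add_mset (brace z Q) P))) (increments zs)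
     = map (\<lambda>ws. graft (z, Suc j) (grafts ws (brace c)) (Q + add_mset b P)) (increments zs)"
  proof (rule map_cong[OF refl])
    fix ws assume ws: "ws \<in> set (increments zs)"
    show "grafts ws (brace c) (add_mset b (add_mset (brace z Q) P)) = graft (z, Suc j) (grafts ws (brace c)) (Q + add_mset b P)"
      using M admissible_grafts[OF admissible_brace increments_nonzero[OF ws nz], of n c] increments_excess[OF ws nz]
      by (subst graft_eq) (simp_all add: add_mset_commute)
  qed
  \<comment> \<open>The branch at \<open>z\<close> counts as one leaf of \<open>?S\<close>; by
    \<open>mul_brace\<close>, acting on it either adds a child to \<open>z\<close> or acts on an
    entry below \<open>z\<close>.\<close>
  also have "ds b ?S (add_mset (brace z Q) P)
    = ?S (add_mset (brace z (add_mset b Q)) P) + ds b (\<lambda>N. ?S (add_mset (brace z N) P)) Q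
      + ds b (\<lambda>N. ?S (add_mset (brace z Q) N)) P"
    using adm(1) M ds_hom[of "\<lambda>x. ?S (add_mset x P)"]
    by (simp add: ds_add_mset mul_brace admissible_add)
  also have "?S (add_mset (brace z (add_mset b Q)) P) = graft (z, Suc (Suc j)) ?S (add_mset b Q + P)"
    using adm M by (intro graft_eq[symmetric]) simp_all
  also have "ds b (\<lambda>N. ?S (add_mset (brace z N) P)) Q = ds b (\<lambda>N. graft (z, Suc j) ?S (N + P)) Q"
    by (rule ds_cong) (use M eq in simp)
  also have "ds b (\<lambda>N. ?S (add_mset (brace z Q) N)) P = ds b (\<lambda>N. graft (z, Suc j) ?S (Q + N)) P"
    by (rule ds_cong) (use M eq in simp)
  finally show ?case
    by (simp add: M(1) zj ds_union comp_def ac_simps)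
qed

end

section \<open>Evaluation of differential monomials\<close>

text \<open>A monomial is the multiset \<open>N\<close> of its unmarked letters together with the order \<open>k\<close> of the
  marked one; being proper means that it has weight \<open>-1\<close> and arises from the product.\<close>
definition proper :: "nat \<Rightarrow> ('b \<times> nat) multiset \<Rightarrow> bool" where
  "proper k N \<longleftrightarrow> k + (\<Sum>zj\<in>#N. snd zj) = size N \<and> (k = 0 \<longrightarrow> N = {#})"

context sls_ring
begin

definition nodes :: "('a \<times> nat) multiset \<Rightarrow> ('a \<times> nat) multiset" where
  "nodes N = filter_mset (\<lambda>zj. snd zj \<noteq> 0) N"

definition leaves :: "('a \<times> nat) multiset \<Rightarrow> 'a multiset" where
  "leaves N = image_mset fst (filter_mset (\<lambda>zj. snd zj = 0) N)"

lemma nodes_simps [simp]: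
  "nodes {#} = {#}" "nodes (M + N) = nodes M + nodes N"
  "nodes (add_mset x N) = (if snd x = 0 then nodes N else add_mset x (nodes N))"
  by (simp_all add: nodes_def)

lemma in_nodes [simp]: "x \<in># nodes N \<longleftrightarrow> x \<in># N \<and> snd x \<noteq> 0"
  by (simp add: nodes_def)

lemma leaves_simps [simp]:
  "leaves {#} = {#}" "leaves (M + N) = leaves M + leaves N"
  "leaves (add_mset x N) = (if snd x = 0 then add_mset (fst x) (leaves N) else leaves N)"
  by (simp_all add: leaves_def)

definition graft_val :: "'a \<Rightarrow> ('a \<times> nat) multiset \<Rightarrow> 'a multiset \<Rightarrow> 'a" where
  "graft_val c Z L = grafts (SOME zs. mset zs = Z) (brace c) L"

text \<open>The order of the marked letter does not occur: it is the number of leaves reaching the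
  root, which the weight condition fixes.\<close>

definition val :: "'a \<Rightarrow> ('a \<times> nat) multiset \<Rightarrow> 'a" where
  "val c N = graft_val c (nodes N) (leaves N)"

lemma graft_val_mset:
  assumes "\<forall>zj\<in>set zs. snd zj \<noteq> 0" "size L = Suc (n + excess zs)"
  shows "graft_val c (mset zs) L = grafts zs (brace c) L"
proof -
  have "mset (SOME ws. mset ws = mset zs) = mset zs" by (rule someI) simp
  then show ?thesis
    unfolding graft_val_def using assms
    by (intro grafts_perm[OF admissible_brace, symmetric]) simp_all
qed

lemma val_empty [simp]: "val c {#} = c"
  by (simp add: val_def graft_val_def)

text \<open>Letter by letter: order \<open>j > 0\<close> gives \<open>j = 1 + (j - 1)\<close>, and
  order 0 gives one leaf. For \<open>proper k N\<close> exactly \<open>k\<close> leaves remain for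
  the root.\<close>

lemma size_leaves_excess:
  assumes "mset zs = nodes N"
  shows "(\<Sum>zj\<in>#N. snd zj) + size (leaves N) = size N + excess zs"
proof -
  have "(\<Sum>zj\<in>#N. snd zj) + size (leaves N) = size N + (\<Sum>zj\<in>#nodes N. snd zj - 1)"
    by (induction N) auto
  also have "(\<Sum>zj\<in>#nodes N. snd zj - 1) = excess zs"
    by (simp only: excess_def sum_mset_sum_list[symmetric] mset_map assms)
  finally show ?thesis .
qed

lemma nodes_list:
  obtains zs where "mset zs = nodes N" "\<forall>zj\<in>set zs. snd zj \<noteq> 0"
proof -
  obtain zs where "mset zs = nodes N" by (metis ex_mset)
  moreover from this have "set zs = set_mset (nodes N)" by (metis set_mset_mset)
  ultimately show ?thesis using that by (simp add: nodes_def)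
qed

lemma graft_val_insert:
  assumes zs: "\<forall>zj\<in>set zs. snd zj \<noteq> 0" "size P = n + excess zs" and h: "proper h N"
  shows "graft_val c (mset zs) (add_mset (val s N) P) =
    graft_val c (mset zs + nodes (add_mset (s, h) N)) (P + leaves (add_mset (s, h) N))"
proof (cases "h = 0")
  case True
  \<comment> \<open>Then \<open>N\<close> is empty and the inserted value is \<open>s\<close>
    itself, the leaf coming from \<open>(s, 0)\<close>.\<close>
  then show ?thesis using h by (simp add: proper_def)
next
  case False
  obtain ws where ws: "mset ws = nodes N" "\<forall>zj\<in>set ws. snd zj \<noteq> 0" by (rule nodes_list)
  have L: "size (leaves N) = h + excess ws"
    using size_leaves_excess[OF ws(1)] h by (simp add: proper_def)
  have "val s N = grafts ws (brace s) (leaves N)"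
    using graft_val_mset[OF ws(2), of "leaves N" "h - 1" s] L False by (simp add: val_def ws)
  moreover have "graft_val c (mset zs) (add_mset x P) = grafts zs (brace c) (add_mset x P)" for x
    using zs by (intro graft_val_mset) simp_all
  moreover have "grafts zs (brace c) (add_mset (grafts ws (brace s) (leaves N)) P)
      = grafts (ws @ [(s, h)]) (grafts zs (brace c)) (leaves N + P)"
    using zs L ws False admissible_grafts[OF admissible_brace zs(1), of n c] by (intro graft_node) simp_all
  moreover have "grafts (ws @ [(s, h)]) (grafts zs (brace c)) (leaves N + P)
      = graft_val c (mset (ws @ (s, h) # zs)) (leaves N + P)"
    using graft_val_mset[of "ws @ (s, h) # zs" "leaves N + P" n c] zs ws L False
    by (simp add: ball_Un)
  ultimately show ?thesis using False ws by (simp add: ac_simps)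
qed

lemma sum_increments:
  "(\<Sum>ws\<leftarrow>increments zs. f (mset ws)) =
   (\<Sum>x\<in>#mset zs. f (add_mset (fst x, Suc (snd x)) (mset zs - {#x#})))"
proof (induction zs arbitrary: f)
  case (Cons zj zs)
  have "(\<Sum>x\<in>#mset zs. f (add_mset (fst x, Suc (snd x)) (mset (zj # zs) - {#x#})))
     = (\<Sum>x\<in>#mset zs. f (add_mset zj (add_mset (fst x, Suc (snd x)) (mset zs - {#x#}))))"
    by (intro arg_cong[where f = sum_mset] image_mset_cong) (auto simp: add_mset_commute)
  then show ?case
    using Cons.IH[of "\<lambda>M. f (add_mset zj M)"] by (simp add: comp_def)
qed simp

lemma sum_nodes_leaves:
  "(\<Sum>x\<in>#N. f x) = (\<Sum>x\<in>#nodes N. f x) + (\<Sum>l\<in>#leaves N. f (l, 0))"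
  by (induction N) (auto simp: ac_simps intro!: arg_cong[where f = f] prod_eqI)

lemma nodes_diff:
  assumes "x \<in># N"
  shows "nodes (N - {#x#}) = (if snd x = 0 then nodes N else nodes N - {#x#})"
    "leaves (N - {#x#}) = (if snd x = 0 then leaves N - {#fst x#} else leaves N)"
proof -
  obtain N' where "N = add_mset x N'" using assms by (metis insert_DiffM)
  then show "nodes (N - {#x#}) = (if snd x = 0 then nodes N else nodes N - {#x#})"
    "leaves (N - {#x#}) = (if snd x = 0 then leaves N - {#fst x#} else leaves N)"
    by simp_all
qed

text \<open>Mirrors the expansion of (N d^h(s)) d(M d^k(r)): d hits \<open>r\<close> in the first
  term and a letter of \<open>M\<close> in the sum. Letters of positive order come from
  \<open>increments\<close> in \<open>mul_grafts\<close>, letters of order 0 from its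
  \<open>ds\<close> term.\<close>

theorem mul_val:
  assumes h: "proper h N" and k: "proper k M"
  shows "val s N \<star> val r M = val r (add_mset (s, h) (N + M)) +
    (\<Sum>x\<in>#M. val r (add_mset (s, h) (N + add_mset (fst x, Suc (snd x)) (M - {#x#}))))"
proof (cases "k = 0")
  case True
  then have M: "M = {#}" using k by (simp add: proper_def)
  have "val s N \<star> r = graft_val r (mset []) (add_mset (val s N) {#})"
    using graft_val_mset[of "[]" "{#val s N#}" 0 r] by simp
  also have "\<dots> = val r (add_mset (s, h) N)"
    using graft_val_insert[of "[]" "{#}" 0 h N r s] h by (simp add: val_def)
  finally show ?thesis by (simp add: M)
next
  case False
  obtain zs where zs: "mset zs = nodes M" "\<forall>zj\<in>set zs. snd zj \<noteq> 0" by (rule nodes_list)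
  define b where "b = val s N"
  \<comment> \<open>The lemmas on grafting count root leaves as \<open>Suc n\<close>, which is why
    \<open>k = 0\<close> was treated apart.\<close>
  define n where "n = k - 1"
  have L: "size (leaves M) = Suc (n + excess zs)"
    using size_leaves_excess[OF zs(1)] k False by (simp add: proper_def n_def)
  have ins: "graft_val r (mset ws) (add_mset b P) = graft_val r (mset ws + nodes (add_mset (s, h) N)) (P + leaves (add_mset (s, h) N))"
    if "\<forall>zj\<in>set ws. snd zj \<noteq> 0" "size P = m + excess ws" for ws P m
    unfolding b_def using that h by (intro graft_val_insert) simp_all
  have "b \<star> val r M = b \<star> grafts zs (brace r) (leaves M)"
    using graft_val_mset[OF zs(2) L] by (simp add: val_def zs)
  also have "\<dots> = grafts zs (brace r) (add_mset b (leaves M))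
      + (\<Sum>ws\<leftarrow>increments zs. grafts ws (brace r) (add_mset b (leaves M)))
      + ds b (grafts zs (brace r)) (leaves M)"
    by (rule mul_grafts[OF zs(2) L])
  also have "grafts zs (brace r) (add_mset b (leaves M)) = graft_val r (mset zs) (add_mset b (leaves M))"
    using zs L by (intro graft_val_mset[where n = "Suc n", symmetric]) simp_all
  also have "\<dots> = val r (add_mset (s, h) (N + M))"
    using ins[OF zs(2), of "leaves M" "Suc n"] L zs(1) by (simp add: val_def ac_simps)
  also have "(\<Sum>ws\<leftarrow>increments zs. grafts ws (brace r) (add_mset b (leaves M)))
    = (\<Sum>ws\<leftarrow>increments zs. graft_val r (mset ws + nodes (add_mset (s, h) N)) (leaves M + leaves (add_mset (s, h) N)))"
  proof (intro arg_cong[where f = sum_list] map_cong refl)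
    fix ws assume "ws \<in> set (increments zs)"
    note ws = increments_nonzero[OF this zs(2)] increments_excess[OF this zs(2)]
    show "grafts ws (brace r) (add_mset b (leaves M)) =
       graft_val r (mset ws + nodes (add_mset (s, h) N)) (leaves M + leaves (add_mset (s, h) N))"
      using graft_val_mset[OF ws(1), of "add_mset b (leaves M)" n r] ins[OF ws(1), of "leaves M" n] L ws(2) by simp
  qed
  also have "\<dots> = (\<Sum>x\<in>#nodes M. graft_val r (add_mset (fst x, Suc (snd x)) (nodes M - {#x#})
      + nodes (add_mset (s, h) N)) (leaves M + leaves (add_mset (s, h) N)))"
    using sum_increments[of "\<lambda>W. graft_val r (W + nodes (add_mset (s, h) N)) (leaves M + leaves (add_mset (s, h) N))" zs]
    by (simp only: zs(1))
  also have "\<dots> = (\<Sum>x\<in>#nodes M. val r (add_mset (s, h) (N + add_mset (fst x, Suc (snd x)) (M - {#x#}))))"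
    by (intro arg_cong[where f = sum_mset] image_mset_cong)
      (auto simp: val_def nodes_diff ac_simps add_mset_commute)
  also have "ds b (grafts zs (brace r)) (leaves M)
    = (\<Sum>l\<in>#leaves M. val r (add_mset (s, h) (N + add_mset (l, Suc 0) (M - {#(l, 0)#}))))"
    unfolding ds_def
  proof (intro arg_cong[where f = sum_mset] image_mset_cong)
    fix l assume l: "l \<in># leaves M"
    then have "(l, 0) \<in># M" by (auto simp: leaves_def)
    then obtain M' where M': "M = add_mset (l, 0) M'" by (metis insert_DiffM)
    have sz: "size (leaves M - {#l#}) = n + excess zs" using L l by (simp add: size_Diff_singleton)
    \<comment> \<open>A leaf hit by \<open>b\<close> becomes a vertex of arity 1 with the single
      child \<open>b\<close>, that is, the letter \<open>(l, 1)\<close>.\<close>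
    have "b \<star> l = brace l {#b#}" by simp
    then have "grafts zs (brace r) (add_mset (b \<star> l) (leaves M - {#l#}))
      = graft (l, 1) (grafts zs (brace r)) ({#b#} + (leaves M - {#l#}))"
      using admissible_grafts[OF admissible_brace zs(2), of n r] sz by (subst graft_eq) simp_all
    also have "\<dots> = graft_val r (mset ((l, 1) # zs)) (add_mset b (leaves M - {#l#}))"
      using zs(2) sz graft_val_mset[of "(l, 1) # zs" "add_mset b (leaves M - {#l#})" n r] by simp
    also have "\<dots> = graft_val r (mset ((l, 1) # zs) + nodes (add_mset (s, h) N)) ((leaves M - {#l#}) + leaves (add_mset (s, h) N))"
      using zs(2) sz by (intro ins[where m = n]) simp_all
    also have "\<dots> = val r (add_mset (s, h) (N + add_mset (l, Suc 0) (M - {#(l, 0)#})))"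
      by (simp add: val_def zs(1) M' ac_simps add_mset_commute)
    finally show "grafts zs (brace r) (add_mset (b \<star> l) (leaves M - {#l#})) = \<dots>" .
  qed
  finally show ?thesis
    unfolding b_def sum_nodes_leaves[of _ M] by (simp add: add.assoc)
qed

end

section \<open>Differential monomials and the free SLS ring\<close>

text \<open>The letter \<open>(i, n)\<close> is the \<open>n\<close>-th derivative of the variable \<open>x\<^sub>i\<close>.  In a Perm-algebra all factors
  but the last commute, so a monomial is a multiset of letters together with its last letter.\<close>
type_synonym letter = "nat \<times> nat"
type_synonym monomial = "letter multiset \<times> letter"

definition mono_mul :: "monomial \<Rightarrow> monomial \<Rightarrow> monomial" where
  "mono_mul m n = (add_mset (snd m) (fst m + fst n), snd n)"

definition raise :: "letter \<Rightarrow> letter" where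
  "raise x = (fst x, Suc (snd x))"

text \<open>A multiset, since repeated letters yield equal monomials, whose multiplicity is the
  integer coefficient.\<close>

definition mono_deriv :: "monomial \<Rightarrow> monomial multiset" where
  "mono_deriv m = add_mset (fst m, raise (snd m))
     {#(add_mset (raise x) (fst m - {#x#}), snd m). x \<in># fst m#}"

definition proper_mono :: "monomial \<Rightarrow> bool" where
  "proper_mono m \<longleftrightarrow> proper (snd (snd m)) (fst m)"

lemma mono_deriv_mul:
  "mono_deriv (mono_mul p q) =
   image_mset (\<lambda>n. mono_mul n q) (mono_deriv p) + image_mset (mono_mul p) (mono_deriv q)"
proof -
  obtain M l N r where pq: "p = (M, l)" "q = (N, r)" by (metis prod.exhaust)
  have "{#(add_mset (raise x) (add_mset l (M + N) - {#x#}), r). x \<in># M#}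
     = {#(add_mset l (add_mset (raise x) (M - {#x#}) + N), r). x \<in># M#}"
    by (intro image_mset_cong) (auto dest!: multi_member_split simp: add_mset_commute)
  moreover have "{#(add_mset (raise x) (add_mset l (M + N) - {#x#}), r). x \<in># N#}
     = {#(add_mset l (M + add_mset (raise x) (N - {#x#})), r). x \<in># N#}"
    by (intro image_mset_cong) (auto dest!: multi_member_split simp: add_mset_commute)
  ultimately show ?thesis
    by (simp add: pq mono_deriv_def mono_mul_def image_mset.compositionality comp_def)
qed

text \<open>Weight, the sum of the orders minus the number of letters, is additive on products and
  raised by 1 by d, and -1 - 1 + 1 = -1. If the last letter of \<open>q\<close> has order 0, then
  \<open>q\<close> is that letter alone and its only derivative raises it.\<close>

lemma proper_mono_mul:
  assumes "proper_mono p" "proper_mono q" "n \<in># mono_deriv q"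
  shows "proper_mono (mono_mul p n)"
  using assms by (auto simp: proper_mono_def proper_def mono_deriv_def mono_mul_def raise_def
      dest!: multi_member_split)

text \<open>Braces have integer coefficients, so the free SLS ring over the integers suffices.  Unlike an
  algebra given by a carrier set it is a type, to which the preceding results apply.\<close>
datatype sls_expr = Gen nat | Zero | Plus sls_expr sls_expr | Neg sls_expr | Times sls_expr sls_expr

inductive sls_eq :: "sls_expr \<Rightarrow> sls_expr \<Rightarrow> bool"  (infix "\<doteq>" 50) where
  refl: "a \<doteq> a"
| sym: "a \<doteq> b \<Longrightarrow> b \<doteq> a"
| trans: "a \<doteq> b \<Longrightarrow> b \<doteq> c \<Longrightarrow> a \<doteq> c"
| plus: "a \<doteq> a' \<Longrightarrow> b \<doteq> b' \<Longrightarrow> Plus a b \<doteq> Plus a' b'"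
| neg: "a \<doteq> a' \<Longrightarrow> Neg a \<doteq> Neg a'"
| times: "a \<doteq> a' \<Longrightarrow> b \<doteq> b' \<Longrightarrow> Times a b \<doteq> Times a' b'"
| plus_assoc: "Plus (Plus a b) c \<doteq> Plus a (Plus b c)"
| plus_commute: "Plus a b \<doteq> Plus b a"
| plus_zero: "Plus Zero a \<doteq> a"
| plus_neg: "Plus (Neg a) a \<doteq> Zero"
| plus_times: "Times (Plus a b) c \<doteq> Plus (Times a c) (Times b c)"
| times_plus: "Times a (Plus b c) \<doteq> Plus (Times a b) (Times a c)"
| left_symmetric:
    "Plus (Times (Times a b) c) (Times b (Times a c)) \<doteq> Plus (Times (Times b a) c) (Times a (Times b c))"
| right_commute: "Times (Times (Times a b) c) e \<doteq> Times (Times (Times a c) b) e"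
| exchange:
    "Plus (Times (Times a (Times b c)) e) (Times b (Times (Times a c) e))
     \<doteq> Plus (Times (Times b (Times a c)) e) (Times a (Times (Times b c) e))"

quotient_type free_sls = sls_expr / sls_eq
  by (intro equivpI reflpI sympI transpI) (blast intro: sls_eq.intros)+

instantiation free_sls :: ab_group_add
begin

lift_definition zero_free_sls :: free_sls is Zero .
lift_definition plus_free_sls :: "free_sls \<Rightarrow> free_sls \<Rightarrow> free_sls" is Plus by (rule sls_eq.plus)
lift_definition uminus_free_sls :: "free_sls \<Rightarrow> free_sls" is Neg by (rule sls_eq.neg)
definition minus_free_sls :: "free_sls \<Rightarrow> free_sls \<Rightarrow> free_sls" where
  "minus_free_sls x y = x + (- y)"

instance
proof
  fix a b c :: free_sls
  show "a + b + c = a + (b + c)" by transfer (rule sls_eq.plus_assoc)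
  show "a + b = b + a" by transfer (rule sls_eq.plus_commute)
  show "0 + a = a" by transfer (rule sls_eq.plus_zero)
  show "- a + a = 0" by transfer (rule sls_eq.plus_neg)
  show "a - b = a + - b" by (rule minus_free_sls_def)
qed

end

lift_definition gen :: "nat \<Rightarrow> free_sls" is Gen .
lift_definition times_free_sls :: "free_sls \<Rightarrow> free_sls \<Rightarrow> free_sls" is Times by (rule sls_eq.times)

interpretation free: sls_ring times_free_sls
  by standard
    (transfer, rule sls_eq.plus_times sls_eq.times_plus sls_eq.left_symmetric sls_eq.right_commute
      sls_eq.exchange)+

definition mono_val :: "monomial \<Rightarrow> free_sls" where
  "mono_val m = free.val (gen (fst (snd m))) (image_mset (apfst gen) (fst m))"

lemma proper_image: "proper k (image_mset (apfst f) N) = proper k N"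
  by (simp add: proper_def image_mset.compositionality comp_def)

lemma times_mono_val:
  assumes "proper_mono m" "proper_mono n"
  shows "times_free_sls (mono_val m) (mono_val n) =
    (\<Sum>p\<in>#mono_deriv n. mono_val (mono_mul m p))"
proof -
  obtain N s h where m: "m = (N, (s, h))" by (metis prod.exhaust)
  obtain M r k where n: "n = (M, (r, k))" by (metis prod.exhaust)
  let ?g = "apfst gen" and ?G = "image_mset (apfst gen)"
  have "times_free_sls (mono_val m) (mono_val n) = free.val (gen r) (add_mset (gen s, h) (?G N + ?G M)) +
      (\<Sum>x\<in>#M. free.val (gen r) (add_mset (gen s, h) (?G N + add_mset (fst (?g x), Suc (snd (?g x))) (?G M - {#?g x#}))))"
    using free.mul_val[of h "?G N" k "?G M" "gen s" "gen r"] assms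
    by (simp add: mono_val_def m n proper_mono_def proper_image image_mset.compositionality comp_def)
  also have "(\<Sum>x\<in>#M. free.val (gen r) (add_mset (gen s, h) (?G N + add_mset (fst (?g x), Suc (snd (?g x))) (?G M - {#?g x#}))))
     = (\<Sum>x\<in>#M. mono_val (mono_mul m (add_mset (raise x) (M - {#x#}), (r, k))))"
    by (intro arg_cong[where f = sum_mset] image_mset_cong)
      (auto dest!: multi_member_split simp: mono_val_def mono_mul_def m raise_def)
  finally show ?thesis
    by (simp add: mono_deriv_def n mono_val_def mono_mul_def m raise_def image_mset.compositionality comp_def)
qed

section \<open>Evaluation of ring expressions in an SLS-algebra given by a carrier set\<close>

primrec eval_expr :: "('k, 'u) module \<Rightarrow> (nat \<Rightarrow> 'u) \<Rightarrow> sls_expr \<Rightarrow> 'u" where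
  "eval_expr A v (Gen i) = v i"
| "eval_expr A v Zero = \<zero>\<^bsub>A\<^esub>"
| "eval_expr A v (Plus a b) = eval_expr A v a \<oplus>\<^bsub>A\<^esub> eval_expr A v b"
| "eval_expr A v (Neg a) = \<ominus>\<^bsub>A\<^esub> eval_expr A v a"
| "eval_expr A v (Times a b) = eval_expr A v a \<otimes>\<^bsub>A\<^esub> eval_expr A v b"

lemma nonassoc_algebraD:
  assumes "nonassoc_algebra K A"
  shows "module K A"
    and "x \<in> carrier A \<Longrightarrow> y \<in> carrier A \<Longrightarrow> x \<otimes>\<^bsub>A\<^esub> y \<in> carrier A"
    and "x \<in> carrier A \<Longrightarrow> y \<in> carrier A \<Longrightarrow> z \<in> carrier A \<Longrightarrow>
      (x \<oplus>\<^bsub>A\<^esub> y) \<otimes>\<^bsub>A\<^esub> z = (x \<otimes>\<^bsub>A\<^esub> z) \<oplus>\<^bsub>A\<^esub> (y \<otimes>\<^bsub>A\<^esub> z)"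
    and "x \<in> carrier A \<Longrightarrow> y \<in> carrier A \<Longrightarrow> z \<in> carrier A \<Longrightarrow>
      x \<otimes>\<^bsub>A\<^esub> (y \<oplus>\<^bsub>A\<^esub> z) = (x \<otimes>\<^bsub>A\<^esub> y) \<oplus>\<^bsub>A\<^esub> (x \<otimes>\<^bsub>A\<^esub> z)"
    and "c \<in> carrier K \<Longrightarrow> x \<in> carrier A \<Longrightarrow> y \<in> carrier A \<Longrightarrow>
      (c \<odot>\<^bsub>A\<^esub> x) \<otimes>\<^bsub>A\<^esub> y = c \<odot>\<^bsub>A\<^esub> (x \<otimes>\<^bsub>A\<^esub> y)"
    and "c \<in> carrier K \<Longrightarrow> x \<in> carrier A \<Longrightarrow> y \<in> carrier A \<Longrightarrow>
      x \<otimes>\<^bsub>A\<^esub> (c \<odot>\<^bsub>A\<^esub> y) = c \<odot>\<^bsub>A\<^esub> (x \<otimes>\<^bsub>A\<^esub> y)"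
  using assms by (auto simp: nonassoc_algebra_def linear_on_def Pi_iff)

lemma (in abelian_group) minus_eq_minus_iff:
  assumes "a \<in> carrier G" "b \<in> carrier G" "c \<in> carrier G" "e \<in> carrier G"
  shows "a \<ominus> b = c \<ominus> e \<longleftrightarrow> a \<oplus> e = c \<oplus> b"
proof -
  have "a \<ominus> b = c \<ominus> e \<longleftrightarrow> (a \<ominus> b) \<oplus> (b \<oplus> e) = (c \<ominus> e) \<oplus> (b \<oplus> e)"
    using assms by simp
  moreover have "(a \<ominus> b) \<oplus> (b \<oplus> e) = a \<oplus> e"
    using assms by (simp add: a_minus_def a_assoc r_neg1)
  moreover have "(c \<ominus> e) \<oplus> (b \<oplus> e) = c \<oplus> b"
    using assms by (simp add: a_comm[of b e] a_minus_def a_assoc r_neg1)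
  ultimately show ?thesis by simp
qed

text \<open>Without subtraction the identities match \<open>sls_ring\<close> and can be written as
  pairs of \<open>alg_term\<close> that involve no scalar.\<close>

lemma SLS_algebra_iff:
  "SLS_algebra K A \<longleftrightarrow> nonassoc_algebra K A \<and>
    (\<forall>x\<in>carrier A. \<forall>y\<in>carrier A. \<forall>z\<in>carrier A.
       ((x \<otimes>\<^bsub>A\<^esub> y) \<otimes>\<^bsub>A\<^esub> z) \<oplus>\<^bsub>A\<^esub> (y \<otimes>\<^bsub>A\<^esub> (x \<otimes>\<^bsub>A\<^esub> z)) =
       ((y \<otimes>\<^bsub>A\<^esub> x) \<otimes>\<^bsub>A\<^esub> z) \<oplus>\<^bsub>A\<^esub> (x \<otimes>\<^bsub>A\<^esub> (y \<otimes>\<^bsub>A\<^esub> z))) \<and>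
    (\<forall>x\<in>carrier A. \<forall>y\<in>carrier A. \<forall>z\<in>carrier A. \<forall>u\<in>carrier A.
       ((x \<otimes>\<^bsub>A\<^esub> y) \<otimes>\<^bsub>A\<^esub> z) \<otimes>\<^bsub>A\<^esub> u = ((x \<otimes>\<^bsub>A\<^esub> z) \<otimes>\<^bsub>A\<^esub> y) \<otimes>\<^bsub>A\<^esub> u) \<and>
    (\<forall>x\<in>carrier A. \<forall>y\<in>carrier A. \<forall>z\<in>carrier A. \<forall>u\<in>carrier A.
       ((x \<otimes>\<^bsub>A\<^esub> (y \<otimes>\<^bsub>A\<^esub> z)) \<otimes>\<^bsub>A\<^esub> u) \<oplus>\<^bsub>A\<^esub> (y \<otimes>\<^bsub>A\<^esub> ((x \<otimes>\<^bsub>A\<^esub> z) \<otimes>\<^bsub>A\<^esub> u)) =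
       ((y \<otimes>\<^bsub>A\<^esub> (x \<otimes>\<^bsub>A\<^esub> z)) \<otimes>\<^bsub>A\<^esub> u) \<oplus>\<^bsub>A\<^esub> (x \<otimes>\<^bsub>A\<^esub> ((y \<otimes>\<^bsub>A\<^esub> z) \<otimes>\<^bsub>A\<^esub> u)))"
proof (cases "nonassoc_algebra K A")
  case True
  then interpret A: module K A by (rule nonassoc_algebraD)
  show ?thesis
    using True nonassoc_algebraD(2)[OF True]
    by (simp add: SLS_algebra_def left_symmetric_algebra_def associator_def A.M.minus_eq_minus_iff)
qed (simp add: SLS_algebra_def left_symmetric_algebra_def)

locale sls_valuation =
  fixes K :: "('k, 'm) ring_scheme" and A :: "('k, 'u) module" and v :: "nat \<Rightarrow> 'u"
  assumes SLS: "SLS_algebra K A" and v: "range v \<subseteq> carrier A"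
begin

lemma nonassoc: "nonassoc_algebra K A"
  using SLS by (simp add: SLS_algebra_iff)

sublocale A: module K A
  by (rule nonassoc_algebraD(1)[OF nonassoc])

lemmas mult_closed [simp] = nonassoc_algebraD(2)[OF nonassoc]

lemma eval_expr_closed [simp]: "eval_expr A v a \<in> carrier A"
  using v by (induction a) auto

lemma eval_expr_cong: "a \<doteq> b \<Longrightarrow> eval_expr A v a = eval_expr A v b"
proof (induction rule: sls_eq.induct)
  case (plus_commute a b)
  then show ?case by (simp add: A.M.a_comm)
qed (use SLS in \<open>simp_all add: A.M.a_assoc A.M.l_neg nonassoc_algebraD(3,4)[OF nonassoc] SLS_algebra_iff\<close>)

definition hom :: "free_sls \<Rightarrow> 'u" where
  "hom x = eval_expr A v (rep_free_sls x)"

lemma hom_abs: "hom (abs_free_sls a) = eval_expr A v a"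
  unfolding hom_def by (rule eval_expr_cong) (rule Quotient_rep_abs[OF Quotient_free_sls sls_eq.refl])

lemma hom_closed [simp]: "hom x \<in> carrier A"
  by (simp add: hom_def)

lemma hom_simps [simp]:
  "hom (gen i) = v i" "hom 0 = \<zero>\<^bsub>A\<^esub>" "hom (x + y) = hom x \<oplus>\<^bsub>A\<^esub> hom y"
  "hom (times_free_sls x y) = hom x \<otimes>\<^bsub>A\<^esub> hom y"
proof -
  obtain a b where ab: "x = abs_free_sls a" "y = abs_free_sls b"
    by (metis Quotient_abs_rep[OF Quotient_free_sls])
  show "hom (x + y) = hom x \<oplus>\<^bsub>A\<^esub> hom y"
    "hom (times_free_sls x y) = hom x \<otimes>\<^bsub>A\<^esub> hom y"
    by (simp_all add: ab hom_abs plus_free_sls.abs_eq times_free_sls.abs_eq)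
  show "hom (gen i) = v i" "hom 0 = \<zero>\<^bsub>A\<^esub>"
    by (simp_all add: gen.abs_eq zero_free_sls.abs_eq hom_abs)
qed

end

section \<open>Free modules\<close>

lemma linear_onD:
  assumes "linear_on K V W f"
  shows "x \<in> carrier V \<Longrightarrow> f x \<in> carrier W"
    and "x \<in> carrier V \<Longrightarrow> y \<in> carrier V \<Longrightarrow> f (x \<oplus>\<^bsub>V\<^esub> y) = f x \<oplus>\<^bsub>W\<^esub> f y"
    and "c \<in> carrier K \<Longrightarrow> x \<in> carrier V \<Longrightarrow> f (c \<odot>\<^bsub>V\<^esub> x) = c \<odot>\<^bsub>W\<^esub> f x"
  using assms by (auto simp: linear_on_def)

lemma linear_on_zero:
  assumes "module K V" "module K W" "linear_on K V W f"
  shows "f \<zero>\<^bsub>V\<^esub> = \<zero>\<^bsub>W\<^esub>"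
proof -
  interpret V: module K V by fact
  interpret W: module K W by fact
  have "f (\<zero>\<^bsub>K\<^esub> \<odot>\<^bsub>V\<^esub> \<zero>\<^bsub>V\<^esub>) = \<zero>\<^bsub>K\<^esub> \<odot>\<^bsub>W\<^esub> f \<zero>\<^bsub>V\<^esub>"
    by (rule linear_onD(3)[OF assms(3)]) simp_all
  then show ?thesis using linear_onD(1)[OF assms(3), of "\<zero>\<^bsub>V\<^esub>"] by simp
qed

lemma linear_on_comp:
  "linear_on K U V f \<Longrightarrow> linear_on K V W g \<Longrightarrow> linear_on K U W (\<lambda>x. g (f x))"
  by (auto simp: linear_on_def Pi_iff)

lemma linear_on_plus:
  assumes W: "module K W" and "linear_on K V W f" "linear_on K V W g"
  shows "linear_on K V W (\<lambda>x. f x \<oplus>\<^bsub>W\<^esub> g x)"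
proof -
  interpret W: module K W by fact
  show ?thesis
    using assms by (auto simp: linear_on_def Pi_iff W.smult_r_distr W.M.a_ac)
qed

lemma linear_on_smult:
  assumes W: "module K W" and "linear_on K V W f" "c \<in> carrier K"
  shows "linear_on K V W (\<lambda>x. c \<odot>\<^bsub>W\<^esub> f x)"
proof -
  interpret W: module K W by fact
  show ?thesis
    using assms
    by (auto simp: linear_on_def Pi_iff W.smult_r_distr W.smult_assoc1[symmetric] W.R.m_comm)
qed

text \<open>Equal summands count with multiplicity, as in \<open>mono_deriv\<close>; the arbitrary
  order of summation is harmless by \<open>foldr_add_perm\<close>.\<close>

definition msum :: "('b, 'm) ring_scheme \<Rightarrow> 'b multiset \<Rightarrow> 'b" where
  "msum A M = foldr (\<lambda>x y. x \<oplus>\<^bsub>A\<^esub> y) (SOME xs. mset xs = M) \<zero>\<^bsub>A\<^esub>"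

context abelian_monoid
begin

lemma foldr_add_perm:
  assumes "set xs \<subseteq> carrier G" "mset xs = mset ys"
  shows "foldr (\<oplus>) xs \<zero> = foldr (\<oplus>) ys \<zero>"
  using assms
proof (induction xs arbitrary: ys)
  case (Cons x xs)
  have closed: "foldr (\<oplus>) zs y \<in> carrier G" if "set zs \<subseteq> carrier G" "y \<in> carrier G" for zs y
    using that by (induction zs) auto
  have "x \<in> set ys" using Cons.prems(2) by (metis list.set_intros(1) set_mset_mset)
  then obtain us vs where ys: "ys = us @ x # vs" by (metis split_list)
  have sub: "set us \<union> set vs \<subseteq> carrier G"
    using Cons.prems ys by (metis Un_subset_iff mset_eq_setD set_append set_subset_Cons subset_trans)
  have x: "x \<in> carrier G" using Cons.prems by simp
  have "foldr (\<oplus>) (us @ x # vs) \<zero> = x \<oplus> foldr (\<oplus>) (us @ vs) \<zero>"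
    using sub x by (induction us) (auto simp: a_lcomm closed)
  moreover have "foldr (\<oplus>) xs \<zero> = foldr (\<oplus>) (us @ vs) \<zero>"
    using Cons.prems ys by (intro Cons.IH) simp_all
  ultimately show ?case using ys by simp
qed simp

lemma msum_mset:
  assumes "set xs \<subseteq> carrier G"
  shows "msum G (mset xs) = foldr (\<oplus>) xs \<zero>"
proof -
  have *: "mset (SOME ys. mset ys = mset xs) = mset xs" by (rule someI) simp
  then have "set (SOME ys. mset ys = mset xs) = set xs" by (rule mset_eq_setD)
  then show ?thesis
    unfolding msum_def using assms * by (intro foldr_add_perm) simp_all
qed

lemma msum_empty [simp]: "msum G {#} = \<zero>"
  using msum_mset[of "[]"] by simp

lemma msum_add_mset [simp]:
  assumes "set_mset M \<subseteq> carrier G" "x \<in> carrier G"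
  shows "msum G (add_mset x M) = x \<oplus> msum G M"
proof -
  obtain xs where "mset xs = M" by (metis ex_mset)
  then show ?thesis using msum_mset[of xs] msum_mset[of "x # xs"] assms by auto
qed

lemma msum_closed [simp]: "set_mset M \<subseteq> carrier G \<Longrightarrow> msum G M \<in> carrier G"
  by (induction M) auto

lemma msum_union:
  "set_mset M \<subseteq> carrier G \<Longrightarrow> set_mset N \<subseteq> carrier G \<Longrightarrow> msum G (M + N) = msum G M \<oplus> msum G N"
  by (induction M) (auto simp: a_assoc)

end

lemma linear_on_msum:
  assumes "module K V" "module K W" "linear_on K V W f" "set_mset M \<subseteq> carrier V"
  shows "f (msum V M) = msum W (image_mset f M)"
proof -
  interpret V: module K V by fact
  interpret W: module K W by fact
  note f = linear_onD[OF assms(3)] linear_on_zero[OF assms(1-3)]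
  from assms(4) show ?thesis
  proof (induction M)
    case (add x M)
    then have "set_mset (image_mset f M) \<subseteq> carrier W" using f(1) by auto
    with add show ?case by (simp add: f)
  qed (simp add: f)
qed

text \<open>The product is a parameter because \<open>conv\<close> is itself defined by linear
  extension from this module; \<open>lin_free_module_mult\<close> resolves the circularity.\<close>

definition free_module ::
    "('k, 'm) ring_scheme \<Rightarrow> (('i \<Rightarrow> 'k) \<Rightarrow> ('i \<Rightarrow> 'k) \<Rightarrow> ('i \<Rightarrow> 'k)) \<Rightarrow> ('k, 'i \<Rightarrow> 'k) module" where
  "free_module K m =
     \<lparr>carrier = {f. range f \<subseteq> carrier K \<and> finite {i. f i \<noteq> \<zero>\<^bsub>K\<^esub>}}, monoid.mult = m, one = undefined,
      ring.zero = (\<lambda>_. \<zero>\<^bsub>K\<^esub>), ring.add = (\<lambda>f g i. f i \<oplus>\<^bsub>K\<^esub> g i), smult = (\<lambda>c f i. c \<otimes>\<^bsub>K\<^esub> f i)\<rparr>"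

definition single :: "('k, 'm) ring_scheme \<Rightarrow> 'i \<Rightarrow> 'i \<Rightarrow> 'k" where
  "single K i = (\<lambda>j. if j = i then \<one>\<^bsub>K\<^esub> else \<zero>\<^bsub>K\<^esub>)"

definition lin :: "('k, 'm) ring_scheme \<Rightarrow> ('k, 'v) module \<Rightarrow> ('i \<Rightarrow> 'v) \<Rightarrow> ('i \<Rightarrow> 'k) \<Rightarrow> 'v" where
  "lin K V \<phi> f = (\<Oplus>\<^bsub>V\<^esub>i\<in>{i. f i \<noteq> \<zero>\<^bsub>K\<^esub>}. f i \<odot>\<^bsub>V\<^esub> \<phi> i)"

lemma free_module_simps [simp]:
  "f \<otimes>\<^bsub>free_module K m\<^esub> g = m f g"
  "\<zero>\<^bsub>free_module K m\<^esub> = (\<lambda>_. \<zero>\<^bsub>K\<^esub>)"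
  "f \<oplus>\<^bsub>free_module K m\<^esub> g = (\<lambda>i. f i \<oplus>\<^bsub>K\<^esub> g i)"
  "c \<odot>\<^bsub>free_module K m\<^esub> f = (\<lambda>i. c \<otimes>\<^bsub>K\<^esub> f i)"
  by (simp_all add: free_module_def)

lemma free_module_carrier:
  "f \<in> carrier (free_module K m) \<longleftrightarrow> (\<forall>i. f i \<in> carrier K) \<and> finite {i. f i \<noteq> \<zero>\<^bsub>K\<^esub>}"
  by (auto simp: free_module_def)

lemma lin_free_module_mult: "lin K (free_module K m) = lin K (free_module K m')"
  by (simp add: fun_eq_iff lin_def finsum_def free_module_def)

context field
begin

lemma module_free_module: "module R (free_module R m)"
proof (rule moduleI)
  show "cring R" by (rule is_cring)
  show "abelian_group (free_module R m)"
  proof (rule abelian_groupI)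
    fix f g assume fg: "f \<in> carrier (free_module R m)" "g \<in> carrier (free_module R m)"
    have "{i. f i \<oplus> g i \<noteq> \<zero>} \<subseteq> {i. f i \<noteq> \<zero>} \<union> {i. g i \<noteq> \<zero>}" using fg by auto
    then show "f \<oplus>\<^bsub>free_module R m\<^esub> g \<in> carrier (free_module R m)"
      using fg by (auto simp: free_module_carrier intro: finite_subset)
  next
    fix f assume f: "f \<in> carrier (free_module R m)"
    have "{i. \<ominus> f i \<noteq> \<zero>} \<subseteq> {i. f i \<noteq> \<zero>}" using f by auto
    then have "(\<lambda>i. \<ominus> f i) \<in> carrier (free_module R m)"
      using f by (auto simp: free_module_carrier intro: finite_subset)
    then show "\<exists>g\<in>carrier (free_module R m). g \<oplus>\<^bsub>free_module R m\<^esub> f = \<zero>\<^bsub>free_module R m\<^esub>"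
      by (rule bexI[rotated]) (use f in \<open>auto simp: free_module_carrier fun_eq_iff l_neg\<close>)
  qed (auto simp: free_module_carrier fun_eq_iff a_ac)
next
  fix c f assume cf: "c \<in> carrier R" "f \<in> carrier (free_module R m)"
  have "{i. c \<otimes> f i \<noteq> \<zero>} \<subseteq> {i. f i \<noteq> \<zero>}" using cf by auto
  then show "c \<odot>\<^bsub>free_module R m\<^esub> f \<in> carrier (free_module R m)"
    using cf by (auto simp: free_module_carrier intro: finite_subset)
qed (auto simp: free_module_carrier fun_eq_iff l_distr r_distr m_assoc)

lemma single_closed [simp]: "single R i \<in> carrier (free_module R m)"
proof -
  have "{j. single R i j \<noteq> \<zero>} = {i}" by (auto simp: single_def)
  then show ?thesis by (auto simp: free_module_carrier single_def)
qed

lemma lin_superset: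
  assumes V: "module R V" and \<phi>: "range \<phi> \<subseteq> carrier V" and f: "\<forall>i. f i \<in> carrier R"
    and I: "finite I" "{i. f i \<noteq> \<zero>} \<subseteq> I"
  shows "lin R V \<phi> f = (\<Oplus>\<^bsub>V\<^esub>i\<in>I. f i \<odot>\<^bsub>V\<^esub> \<phi> i)"
proof -
  interpret V: module R V by fact
  have "f i \<in> carrier R" "\<phi> i \<in> carrier V" for i using f \<phi> by auto
  then show ?thesis
    unfolding lin_def using I by (intro V.M.add.finprod_mono_neutral_cong_left) auto
qed

lemma linear_lin:
  assumes V: "module R V" and \<phi>: "range \<phi> \<subseteq> carrier V"
  shows "linear_on R (free_module R m) V (lin R V \<phi>)"
proof -
  interpret V: module R V by fact
  interpret F: module R "free_module R m" by (rule module_free_module)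
  have [simp]: "\<phi> i \<in> carrier V" for i using \<phi> by auto
  have cl: "f i \<in> carrier R" if "f \<in> carrier (free_module R m)" for f i
    using that by (auto simp: free_module_carrier)
  have sup: "lin R V \<phi> f = (\<Oplus>\<^bsub>V\<^esub>i\<in>I. f i \<odot>\<^bsub>V\<^esub> \<phi> i)"
    if "f \<in> carrier (free_module R m)" "finite I" "{i. f i \<noteq> \<zero>} \<subseteq> I" for f I
    using that \<phi> V by (intro lin_superset) (simp_all add: free_module_carrier)
  show ?thesis
    unfolding linear_on_def
  proof (intro conjI ballI funcsetI)
    fix f assume f: "f \<in> carrier (free_module R m)"
    show "lin R V \<phi> f \<in> carrier V"
      unfolding lin_def using f cl by (intro V.M.finsum_closed) auto
  next
    fix f g assume fg: "f \<in> carrier (free_module R m)" "g \<in> carrier (free_module R m)"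
    let ?I = "{i. f i \<noteq> \<zero>} \<union> {i. g i \<noteq> \<zero>}"
    have I: "finite ?I" using fg by (simp add: free_module_carrier)
    have "{i. (f \<oplus>\<^bsub>free_module R m\<^esub> g) i \<noteq> \<zero>} \<subseteq> ?I" using fg by auto
    then have "lin R V \<phi> (f \<oplus>\<^bsub>free_module R m\<^esub> g)
      = (\<Oplus>\<^bsub>V\<^esub>i\<in>?I. (f \<oplus>\<^bsub>free_module R m\<^esub> g) i \<odot>\<^bsub>V\<^esub> \<phi> i)"
      using fg I by (intro sup F.M.a_closed)
    also have "\<dots> = (\<Oplus>\<^bsub>V\<^esub>i\<in>?I. f i \<odot>\<^bsub>V\<^esub> \<phi> i \<oplus>\<^bsub>V\<^esub> g i \<odot>\<^bsub>V\<^esub> \<phi> i)"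
      using fg cl by (intro V.M.finsum_cong') (auto simp: V.smult_l_distr)
    also have "\<dots> = lin R V \<phi> f \<oplus>\<^bsub>V\<^esub> lin R V \<phi> g"
      using fg cl I by (subst V.M.finsum_addf) (auto simp: sup[of f ?I] sup[of g ?I])
    finally show "lin R V \<phi> (f \<oplus>\<^bsub>free_module R m\<^esub> g) = \<dots>" .
  next
    fix c f assume cf: "c \<in> carrier R" "f \<in> carrier (free_module R m)"
    have I: "finite {i. f i \<noteq> \<zero>}" using cf by (simp add: free_module_carrier)
    have "{i. (c \<odot>\<^bsub>free_module R m\<^esub> f) i \<noteq> \<zero>} \<subseteq> {i. f i \<noteq> \<zero>}" using cf by auto
    then have "lin R V \<phi> (c \<odot>\<^bsub>free_module R m\<^esub> f)
      = (\<Oplus>\<^bsub>V\<^esub>i\<in>{i. f i \<noteq> \<zero>}. (c \<odot>\<^bsub>free_module R m\<^esub> f) i \<odot>\<^bsub>V\<^esub> \<phi> i)"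
      using cf I by (intro sup F.smult_closed)
    also have "\<dots> = (\<Oplus>\<^bsub>V\<^esub>i\<in>{i. f i \<noteq> \<zero>}. c \<odot>\<^bsub>V\<^esub> (f i \<odot>\<^bsub>V\<^esub> \<phi> i))"
      using cf cl by (intro V.M.finsum_cong') (auto simp: V.smult_assoc1)
    also have "\<dots> = c \<odot>\<^bsub>V\<^esub> lin R V \<phi> f"
      unfolding lin_def using cf cl I by (intro V.finsum_smult_ldistr[symmetric]) auto
    finally show "lin R V \<phi> (c \<odot>\<^bsub>free_module R m\<^esub> f) = \<dots>" .
  qed
qed

lemma lin_single:
  assumes V: "module R V" and \<phi>: "range \<phi> \<subseteq> carrier V"
  shows "lin R V \<phi> (single R i) = \<phi> i"
proof -
  interpret V: module R V by fact
  have "\<phi> i \<in> carrier V" using \<phi> by auto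
  moreover have "{j. single R i j \<noteq> \<zero>} = {i}" by (auto simp: single_def)
  ultimately show ?thesis by (simp add: lin_def single_def V.M.finsum_insert)
qed

text \<open>\<open>S\<close> bounds the support, so that the step, and with it
  \<open>linear_on_ext\<close>, treats only basis vectors occurring in \<open>f\<close>. This
  matters for \<open>realize\<close>, whose multiplicativity is established on proper
  monomials.\<close>

lemma free_module_induct [consumes 2, case_names zero step]:
  assumes "f \<in> carrier (free_module R m)" "{i. f i \<noteq> \<zero>} \<subseteq> S"
    and zero: "P (\<lambda>_. \<zero>)"
    and step: "\<And>c i g. c \<in> carrier R \<Longrightarrow> i \<in> S \<Longrightarrow> g \<in> carrier (free_module R m) \<Longrightarrow> P g \<Longrightarrow>
      P (c \<odot>\<^bsub>free_module R m\<^esub> single R i \<oplus>\<^bsub>free_module R m\<^esub> g)"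
  shows "P f"
proof -
  have "finite {i. f i \<noteq> \<zero>}" using assms(1) by (simp add: free_module_carrier)
  then show ?thesis
    using assms(1,2)
  proof (induction "{i. f i \<noteq> \<zero>}" arbitrary: f rule: finite_induct)
    case empty
    then have "f = (\<lambda>_. \<zero>)" by auto
    then show ?case using zero by simp
  next
    case (insert i I)
    define g where "g = f(i := \<zero>)"
    have cl: "f j \<in> carrier R" for j using insert.prems(1) by (auto simp: free_module_carrier)
    have "I = {j. g j \<noteq> \<zero>}" using insert.hyps(2,4) by (auto simp: g_def)
    moreover have "g \<in> carrier (free_module R m)"
      using insert.hyps(1) \<open>I = {j. g j \<noteq> \<zero>}\<close> cl by (auto simp: free_module_carrier g_def)
    moreover have "{j. g j \<noteq> \<zero>} \<subseteq> S" using insert.prems(2) by (auto simp: g_def)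
    ultimately have "P (f i \<odot>\<^bsub>free_module R m\<^esub> single R i \<oplus>\<^bsub>free_module R m\<^esub> g)"
      using insert.prems(2) insert.hyps(4) cl by (intro step insert.hyps(3)) auto
    also have "f i \<odot>\<^bsub>free_module R m\<^esub> single R i \<oplus>\<^bsub>free_module R m\<^esub> g = f"
      using cl by (auto simp: fun_eq_iff g_def single_def)
    finally show ?case .
  qed
qed

lemma linear_on_ext:
  assumes V: "module R V" and \<alpha>: "linear_on R (free_module R m) V \<alpha>" and \<beta>: "linear_on R (free_module R m) V \<beta>"
    and f: "f \<in> carrier (free_module R m)" and "\<And>i. f i \<noteq> \<zero> \<Longrightarrow> \<alpha> (single R i) = \<beta> (single R i)"
  shows "\<alpha> f = \<beta> f"
proof -
  note F = module_free_module[of m]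
  interpret F: module R "free_module R m" by (rule F)
  show ?thesis
    using f order_refl
  proof (induction f rule: free_module_induct)
    case zero
    show ?case using linear_on_zero[OF F V \<alpha>] linear_on_zero[OF F V \<beta>] by simp
  next
    case (step c i g)
    then show ?case
      by (simp add: linear_onD[OF \<alpha>] linear_onD[OF \<beta>] assms(5) del: free_module_simps)
  qed
qed

lemma linear_on_supported:
  assumes "linear_on R (free_module R m) (free_module R m') \<alpha>"
    and "\<And>i. f i \<noteq> \<zero> \<Longrightarrow> {j. \<alpha> (single R i) j \<noteq> \<zero>} \<subseteq> T"
    and f: "f \<in> carrier (free_module R m)"
  shows "{j. \<alpha> f j \<noteq> \<zero>} \<subseteq> T"
  using f order_refl
proof (induction f rule: free_module_induct)
  case zero
  show ?case using linear_on_zero[OF module_free_module module_free_module assms(1)] by simp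
next
  case (step c i g)
  interpret F: module R "free_module R m" by (rule module_free_module)
  have "\<alpha> (c \<odot>\<^bsub>free_module R m\<^esub> single R i \<oplus>\<^bsub>free_module R m\<^esub> g) =
      c \<odot>\<^bsub>free_module R m'\<^esub> \<alpha> (single R i) \<oplus>\<^bsub>free_module R m'\<^esub> \<alpha> g"
    using step by (simp add: linear_onD[OF assms(1)] del: free_module_simps)
  moreover have "{j. \<alpha> (single R i) j \<noteq> \<zero>} \<subseteq> T" using step assms(2) by simp
  moreover from this have "\<alpha> (single R i) x = \<zero> \<and> \<alpha> g x = \<zero>" if "x \<notin> T" for x
    using that step(4) by auto
  ultimately show ?case using step(1) by fastforce
qed

end

section \<open>The free differential Perm-algebra\<close>

declare free_module_simps [simp del]

text \<open>The multiplication of the free module is left \<open>undefined\<close> here because \<open>lin\<close> does not depend on it.\<close>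
definition conv :: "('k, 'm) ring_scheme \<Rightarrow> (monomial \<Rightarrow> 'k) \<Rightarrow> (monomial \<Rightarrow> 'k) \<Rightarrow> monomial \<Rightarrow> 'k" where
  "conv K f g = lin K (free_module K undefined)
     (\<lambda>p. lin K (free_module K undefined) (\<lambda>q. single K (mono_mul p q)) g) f"

definition free_perm :: "('k, 'm) ring_scheme \<Rightarrow> ('k, monomial \<Rightarrow> 'k) module" where
  "free_perm K = free_module K (conv K)"

definition free_deriv :: "('k, 'm) ring_scheme \<Rightarrow> (monomial \<Rightarrow> 'k) \<Rightarrow> monomial \<Rightarrow> 'k" where
  "free_deriv K = lin K (free_perm K)
     (\<lambda>m. msum (free_perm K) (image_mset (single K) (mono_deriv m)))"

lemma free_perm_mult: "f \<otimes>\<^bsub>free_perm K\<^esub> g = conv K f g"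
  by (simp add: free_perm_def free_module_simps)

lemma conv_eq:
  "conv K f g = lin K (free_perm K) (\<lambda>p. lin K (free_perm K) (\<lambda>q. single K (mono_mul p q)) g) f"
  by (simp only: conv_def[of K f g] free_perm_def lin_free_module_mult[of K undefined "conv K"])

context field
begin

abbreviation "F \<equiv> free_perm R"

lemma module_free_perm: "module R F"
  unfolding free_perm_def by (rule module_free_module)

lemma single_closed_perm [simp]: "single R i \<in> carrier F"
  by (simp add: free_perm_def)

lemma linear_lin_perm: "module R V \<Longrightarrow> range \<phi> \<subseteq> carrier V \<Longrightarrow> linear_on R F V (lin R V \<phi>)"
  unfolding free_perm_def by (rule linear_lin)

lemmas linear_on_ext_perm = linear_on_ext[of _ "conv R", folded free_perm_def]

lemma linear_conv_left: "g \<in> carrier F \<Longrightarrow> linear_on R F F (\<lambda>f. conv R f g)"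
  unfolding conv_eq
  by (intro linear_lin_perm module_free_perm)
    (auto intro!: linear_onD(1)[OF linear_lin_perm] module_free_perm)

lemma conv_single_left:
  "g \<in> carrier F \<Longrightarrow> conv R (single R p) g = lin R F (\<lambda>q. single R (mono_mul p q)) g"
  unfolding conv_eq
  by (subst lin_single) (auto intro!: linear_onD(1)[OF linear_lin_perm] module_free_perm)

lemma linear_conv_single: "linear_on R F F (conv R (single R p))"
proof -
  interpret F: module R F by (rule module_free_perm)
  have "linear_on R F F (lin R F (\<lambda>q. single R (mono_mul p q)))"
    by (intro linear_lin_perm module_free_perm) auto
  then show ?thesis by (simp add: linear_on_def conv_single_left Pi_iff)
qed

lemma conv_single_single [simp]: "conv R (single R p) (single R q) = single R (mono_mul p q)"
  by (subst conv_single_left, simp, rule lin_single[OF module_free_perm]) auto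

lemma conv_closed [simp]: "f \<in> carrier F \<Longrightarrow> g \<in> carrier F \<Longrightarrow> conv R f g \<in> carrier F"
  by (rule linear_onD(1)[OF linear_conv_left])

text \<open>Linearity in the first argument is built into \<open>conv\<close>. Linearity in the
  second is therefore checked for basis vectors \<open>f\<close> and extended by
  \<open>linear_on_ext_perm\<close>.\<close>

lemma linear_conv_right:
  assumes f: "f \<in> carrier F"
  shows "linear_on R F F (conv R f)"
proof -
  interpret F: module R F by (rule module_free_perm)
  note single = linear_onD[OF linear_conv_single]
  have "conv R f (g \<oplus>\<^bsub>F\<^esub> h) = conv R f g \<oplus>\<^bsub>F\<^esub> conv R f h"
    if "g \<in> carrier F" "h \<in> carrier F" for g h
    by (rule linear_on_ext_perm[OF module_free_perm _ _ f, where \<alpha> = "\<lambda>f. conv R f (g \<oplus>\<^bsub>F\<^esub> h)"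
          and \<beta> = "\<lambda>f. conv R f g \<oplus>\<^bsub>F\<^esub> conv R f h"])
      (simp_all add: that single linear_on_plus module_free_perm linear_conv_left)
  moreover have "conv R f (c \<odot>\<^bsub>F\<^esub> g) = c \<odot>\<^bsub>F\<^esub> conv R f g"
    if "c \<in> carrier R" "g \<in> carrier F" for c g
    by (rule linear_on_ext_perm[OF module_free_perm _ _ f, where \<alpha> = "\<lambda>f. conv R f (c \<odot>\<^bsub>F\<^esub> g)"
          and \<beta> = "\<lambda>f. c \<odot>\<^bsub>F\<^esub> conv R f g"])
      (simp_all add: that single linear_on_smult module_free_perm linear_conv_left)
  ultimately show ?thesis using f by (simp add: linear_on_def)
qed

text \<open>The arguments are freed from basis vectors one at a time, beginning with the
  last.\<close>

lemma trilinear_ext: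
  assumes \<alpha>: "\<And>g h. g \<in> carrier F \<Longrightarrow> h \<in> carrier F \<Longrightarrow> linear_on R F F (\<lambda>f. \<alpha> f g h)"
      "\<And>f h. f \<in> carrier F \<Longrightarrow> h \<in> carrier F \<Longrightarrow> linear_on R F F (\<lambda>g. \<alpha> f g h)"
      "\<And>f g. f \<in> carrier F \<Longrightarrow> g \<in> carrier F \<Longrightarrow> linear_on R F F (\<lambda>h. \<alpha> f g h)"
    and \<beta>: "\<And>g h. g \<in> carrier F \<Longrightarrow> h \<in> carrier F \<Longrightarrow> linear_on R F F (\<lambda>f. \<beta> f g h)"
      "\<And>f h. f \<in> carrier F \<Longrightarrow> h \<in> carrier F \<Longrightarrow> linear_on R F F (\<lambda>g. \<beta> f g h)"
      "\<And>f g. f \<in> carrier F \<Longrightarrow> g \<in> carrier F \<Longrightarrow> linear_on R F F (\<lambda>h. \<beta> f g h)"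
    and eq: "\<And>p q r. \<alpha> (single R p) (single R q) (single R r) = \<beta> (single R p) (single R q) (single R r)"
    and "f \<in> carrier F" "g \<in> carrier F" "h \<in> carrier F"
  shows "\<alpha> f g h = \<beta> f g h"
proof -
  have 1: "\<alpha> (single R p) (single R q) h = \<beta> (single R p) (single R q) h" if "h \<in> carrier F" for p q h
    by (rule linear_on_ext_perm[OF module_free_perm \<alpha>(3) \<beta>(3)]) (simp_all add: that eq)
  have 2: "\<alpha> (single R p) g h = \<beta> (single R p) g h" if "g \<in> carrier F" "h \<in> carrier F" for p g h
    by (rule linear_on_ext_perm[OF module_free_perm \<alpha>(2) \<beta>(2)]) (simp_all add: that 1)
  show ?thesis
    by (rule linear_on_ext_perm[OF module_free_perm \<alpha>(1) \<beta>(1)]) (simp_all add: assms(8-) 2)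
qed

lemma Perm_algebra_free_perm: "Perm_algebra R F"
proof -
  note lin = linear_conv_right linear_on_comp[OF _ linear_conv_left] linear_on_comp[OF _ linear_conv_right]
    linear_conv_left
  have "conv R (conv R f g) h = conv R f (conv R g h)"
    if "f \<in> carrier F" "g \<in> carrier F" "h \<in> carrier F" for f g h
    by (rule trilinear_ext[OF _ _ _ _ _ _ _ that, where \<alpha> = "\<lambda>f g h. conv R (conv R f g) h"
          and \<beta> = "\<lambda>f g h. conv R f (conv R g h)"])
      (auto intro!: lin simp: mono_mul_def add.assoc add_mset_commute)
  moreover have "conv R (conv R f g) h = conv R (conv R g f) h"
    if "f \<in> carrier F" "g \<in> carrier F" "h \<in> carrier F" for f g h
    by (rule trilinear_ext[OF _ _ _ _ _ _ _ that, where \<alpha> = "\<lambda>f g h. conv R (conv R f g) h"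
          and \<beta> = "\<lambda>f g h. conv R (conv R g f) h"])
      (auto intro!: lin simp: mono_mul_def ac_simps add_mset_commute)
  ultimately show ?thesis
    by (simp add: Perm_algebra_def nonassoc_algebra_def free_perm_mult module_free_perm
        linear_conv_left linear_conv_right)
qed

lemma msum_single_closed [simp]: "msum F (image_mset (\<lambda>x. single R (f x)) M) \<in> carrier F"
proof -
  interpret F: module R F by (rule module_free_perm)
  show ?thesis by (intro F.M.msum_closed) auto
qed

lemma linear_free_deriv: "linear_on R F F (free_deriv R)"
  unfolding free_deriv_def
  using msum_single_closed[of "\<lambda>x. x"] by (intro linear_lin_perm module_free_perm) auto

lemma free_deriv_single:
  "free_deriv R (single R m) = msum F (image_mset (single R) (mono_deriv m))"
  unfolding free_deriv_def
  using msum_single_closed[of "\<lambda>x. x"] by (intro lin_single module_free_perm) auto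

lemma linear_on_msum_single:
  assumes "module R V" "linear_on R F V \<alpha>"
  shows "\<alpha> (msum F (image_mset (\<lambda>x. single R (f x)) M)) = msum V (image_mset (\<lambda>x. \<alpha> (single R (f x))) M)"
  using linear_on_msum[OF module_free_perm assms, of "image_mset (\<lambda>x. single R (f x)) M"]
  by (simp add: image_mset.compositionality comp_def image_subset_iff)

text \<open>On monomials this is \<open>mono_deriv_mul\<close>; it is extended linearly in
  \<open>g\<close>, then in \<open>f\<close>.\<close>

lemma derivation_free_deriv: "derivation R F (free_deriv R)"
proof -
  interpret F: module R F by (rule module_free_perm)
  note cl [simp] = linear_onD(1)[OF linear_free_deriv]
  note lin = linear_conv_right linear_on_comp[OF _ linear_free_deriv] linear_on_comp[OF _ linear_conv_left]
    linear_on_comp[OF _ linear_conv_right] linear_conv_left linear_on_plus[OF module_free_perm] linear_free_deriv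
  have 1: "free_deriv R (conv R (single R p) (single R q)) =
      conv R (free_deriv R (single R p)) (single R q) \<oplus>\<^bsub>F\<^esub> conv R (single R p) (free_deriv R (single R q))" for p q
  proof -
    have "conv R (free_deriv R (single R p)) (single R q) = msum F (image_mset (\<lambda>n. single R (mono_mul n q)) (mono_deriv p))"
      using linear_on_msum_single[OF module_free_perm linear_conv_left[of "single R q"], of "\<lambda>x. x" "mono_deriv p"]
      by (simp add: free_deriv_single)
    moreover have "conv R (single R p) (free_deriv R (single R q)) = msum F (image_mset (\<lambda>n. single R (mono_mul p n)) (mono_deriv q))"
      using linear_on_msum_single[OF module_free_perm linear_conv_single[of p], of "\<lambda>x. x" "mono_deriv q"]
      by (simp add: free_deriv_single)
    ultimately show ?thesis
      by (simp add: free_deriv_single mono_deriv_mul image_mset.compositionality comp_def)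
        (rule F.M.msum_union; auto)
  qed
  have 2: "free_deriv R (conv R (single R p) g) =
      conv R (free_deriv R (single R p)) g \<oplus>\<^bsub>F\<^esub> conv R (single R p) (free_deriv R g)"
    if g: "g \<in> carrier F" for p g
    by (rule linear_on_ext_perm[OF module_free_perm _ _ g, where \<alpha> = "\<lambda>g. free_deriv R (conv R (single R p) g)"
          and \<beta> = "\<lambda>g. conv R (free_deriv R (single R p)) g \<oplus>\<^bsub>F\<^esub> conv R (single R p) (free_deriv R g)"])
      (auto intro!: lin simp: 1[simplified])
  have "free_deriv R (conv R f g) = conv R (free_deriv R f) g \<oplus>\<^bsub>F\<^esub> conv R f (free_deriv R g)"
    if f: "f \<in> carrier F" and g: "g \<in> carrier F" for f g
    by (rule linear_on_ext_perm[OF module_free_perm _ _ f, where \<alpha> = "\<lambda>f. free_deriv R (conv R f g)"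
          and \<beta> = "\<lambda>f. conv R (free_deriv R f) g \<oplus>\<^bsub>F\<^esub> conv R f (free_deriv R g)"])
      (auto intro!: lin simp: g 2)
  then show ?thesis
    by (simp add: derivation_def linear_free_deriv free_perm_mult)
qed

lemma differential_Perm_algebra_free: "differential_Perm_algebra R F (free_deriv R)"
  by (simp add: differential_Perm_algebra_def Perm_algebra_free_perm derivation_free_deriv)

text \<open>Only an inclusion, since in positive characteristic a multiplicity may vanish in the
  field.\<close>

lemma supp_msum_single: "{j. msum F (image_mset (\<lambda>x. single R (f x)) M) j \<noteq> \<zero>} \<subseteq> f ` set_mset M"
proof (induction M)
  case empty
  interpret F: module R F by (rule module_free_perm)
  show ?case by simp (simp add: free_perm_def free_module_simps)
next
  case (add x M)
  interpret F: module R F by (rule module_free_perm)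
  have "msum F (image_mset (\<lambda>x. single R (f x)) (add_mset x M))
      = (\<lambda>j. single R (f x) j \<oplus> msum F (image_mset (\<lambda>x. single R (f x)) M) j)"
    using F.M.msum_add_mset[of "image_mset (\<lambda>x. single R (f x)) M" "single R (f x)"]
    by (auto simp: free_perm_def free_module_simps image_subset_iff)
  moreover have "msum F (image_mset (\<lambda>x. single R (f x)) M) j = \<zero>" if "j \<notin> f ` set_mset M" for j
    using add.IH that by blast
  ultimately show ?case by (auto simp: single_def split: if_splits)
qed

end

definition deriv_algebra :: "('k, 'u) module \<Rightarrow> ('u \<Rightarrow> 'u) \<Rightarrow> ('k, 'u) module" where
  "deriv_algebra P d = P\<lparr>monoid.mult := (\<lambda>x y. x \<otimes>\<^bsub>P\<^esub> d y)\<rparr>"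

lemma deriv_algebra_simps [simp]:
  "carrier (deriv_algebra P d) = carrier P" "x \<otimes>\<^bsub>deriv_algebra P d\<^esub> y = x \<otimes>\<^bsub>P\<^esub> d y"
  "x \<oplus>\<^bsub>deriv_algebra P d\<^esub> y = x \<oplus>\<^bsub>P\<^esub> y" "\<zero>\<^bsub>deriv_algebra P d\<^esub> = \<zero>\<^bsub>P\<^esub>"
  "c \<odot>\<^bsub>deriv_algebra P d\<^esub> x = c \<odot>\<^bsub>P\<^esub> x"
  by (simp_all add: deriv_algebra_def)

definition generator :: "('k, 'm) ring_scheme \<Rightarrow> nat \<Rightarrow> monomial \<Rightarrow> 'k" where
  "generator K i = single K ({#}, (i, 0))"

context sls_valuation
begin

lemma hom_sum_mset: "hom (\<Sum>x\<in>#M. f x) = msum A (image_mset (\<lambda>x. hom (f x)) M)"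
  by (induction M) (auto simp: A.M.msum_add_mset image_subset_iff)

text \<open>Linear on all of F, although \<open>mono_val\<close> has its intended meaning on proper
  monomials.\<close>

definition realize :: "(monomial \<Rightarrow> 'k) \<Rightarrow> 'u" where
  "realize = lin K A (\<lambda>m. hom (mono_val m))"

context
  assumes fld: "field K"
begin

interpretation K: field K by (rule fld)

lemma linear_realize: "linear_on K (free_perm K) A realize"
  unfolding realize_def by (rule K.linear_lin_perm) (auto intro: A.module_axioms)

lemma realize_single: "realize (single K m) = hom (mono_val m)"
  unfolding realize_def by (rule K.lin_single) (auto intro: A.module_axioms)

text \<open>By bilinearity the first claim reduces to \<open>times_mono_val\<close>. The second
  keeps products in the span of proper monomials, so that the first applies to iterated
  products.\<close>

lemma realize_mult:
  assumes f: "f \<in> carrier (free_perm K)" "{m. f m \<noteq> \<zero>\<^bsub>K\<^esub>} \<subseteq> Collect proper_mono"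
    and g: "g \<in> carrier (free_perm K)" "{m. g m \<noteq> \<zero>\<^bsub>K\<^esub>} \<subseteq> Collect proper_mono"
  shows "realize (conv K f (free_deriv K g)) = realize f \<otimes>\<^bsub>A\<^esub> realize g"
    and "{m. conv K f (free_deriv K g) m \<noteq> \<zero>\<^bsub>K\<^esub>} \<subseteq> Collect proper_mono"
proof -
  note cl [simp] = linear_onD(1)[OF K.linear_free_deriv]
  have lin_mult: "linear_on K A A (\<lambda>y. x \<otimes>\<^bsub>A\<^esub> y)" "linear_on K A A (\<lambda>y. y \<otimes>\<^bsub>A\<^esub> x)"
    if "x \<in> carrier A" for x
    using nonassoc that by (auto simp: nonassoc_algebra_def)
  have single: "conv K (single K m) (free_deriv K (single K n)) =
      msum (free_perm K) (image_mset (\<lambda>p. single K (mono_mul m p)) (mono_deriv n))" for m n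
    using K.linear_on_msum_single[OF K.module_free_perm K.linear_conv_single[of m], of "\<lambda>x. x" "mono_deriv n"]
    by (simp add: K.free_deriv_single)
  have lin_right: "linear_on K (free_perm K) (free_perm K) (\<lambda>g. conv K f (free_deriv K g))"
    if "f \<in> carrier (free_perm K)" for f
    using K.linear_free_deriv K.linear_conv_right[OF that] by (rule linear_on_comp)
  have lin_left: "linear_on K (free_perm K) (free_perm K) (\<lambda>f. conv K f (free_deriv K g))"
    using g by (intro K.linear_conv_left) simp
  have 1: "realize (conv K (single K m) (free_deriv K g)) = realize (single K m) \<otimes>\<^bsub>A\<^esub> realize g"
    if m: "proper_mono m" for m
  proof (rule K.linear_on_ext_perm[OF A.module_axioms _ _ g(1), where
        \<alpha> = "\<lambda>g. realize (conv K (single K m) (free_deriv K g))" and \<beta> = "\<lambda>g. realize (single K m) \<otimes>\<^bsub>A\<^esub> realize g"])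
    show "linear_on K (free_perm K) A (\<lambda>g. realize (conv K (single K m) (free_deriv K g)))"
      by (rule linear_on_comp[OF lin_right linear_realize]) simp
    show "linear_on K (free_perm K) A (\<lambda>g. realize (single K m) \<otimes>\<^bsub>A\<^esub> realize g)"
      by (rule linear_on_comp[OF linear_realize lin_mult(1)]) (simp add: realize_single)
    fix n assume "g n \<noteq> \<zero>\<^bsub>K\<^esub>"
    then have n: "proper_mono n" using g by auto
    show "realize (conv K (single K m) (free_deriv K (single K n))) = realize (single K m) \<otimes>\<^bsub>A\<^esub> realize (single K n)"
      using K.linear_on_msum_single[OF A.module_axioms linear_realize, of "mono_mul m" "mono_deriv n"]
        arg_cong[OF times_mono_val[OF m n], of hom]
      by (simp add: single realize_single hom_sum_mset)
  qed
  show "realize (conv K f (free_deriv K g)) = realize f \<otimes>\<^bsub>A\<^esub> realize g"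
  proof (rule K.linear_on_ext_perm[OF A.module_axioms _ _ f(1), where
        \<alpha> = "\<lambda>f. realize (conv K f (free_deriv K g))" and \<beta> = "\<lambda>f. realize f \<otimes>\<^bsub>A\<^esub> realize g"])
    show "linear_on K (free_perm K) A (\<lambda>f. realize (conv K f (free_deriv K g)))"
      by (rule linear_on_comp[OF lin_left linear_realize])
    show "linear_on K (free_perm K) A (\<lambda>f. realize f \<otimes>\<^bsub>A\<^esub> realize g)"
      using linear_onD(1)[OF linear_realize g(1)] by (intro linear_on_comp[OF linear_realize lin_mult(2)])
  qed (use f 1 in auto)
  have 2: "{p. conv K (single K m) (free_deriv K g) p \<noteq> \<zero>\<^bsub>K\<^esub>} \<subseteq> Collect proper_mono" if m: "proper_mono m" for m
  proof (rule K.linear_on_supported[OF lin_right[unfolded free_perm_def] _ g(1)[unfolded free_perm_def], of "single K m"])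
    show "single K m \<in> carrier (free_module K (conv K))" by simp
    fix n assume "g n \<noteq> \<zero>\<^bsub>K\<^esub>"
    then have n: "proper_mono n" using g by auto
    show "{j. conv K (single K m) (free_deriv K (single K n)) j \<noteq> \<zero>\<^bsub>K\<^esub>} \<subseteq> Collect proper_mono"
      using K.supp_msum_single[of "mono_mul m" "mono_deriv n"] proper_mono_mul[OF m n]
      unfolding single by blast
  qed
  show "{m. conv K f (free_deriv K g) m \<noteq> \<zero>\<^bsub>K\<^esub>} \<subseteq> Collect proper_mono"
  proof (rule K.linear_on_supported[OF lin_left[unfolded free_perm_def] _ f(1)[unfolded free_perm_def]])
    fix m assume "f m \<noteq> \<zero>\<^bsub>K\<^esub>"
    then have "proper_mono m" using f by auto
    then show "{p. conv K (single K m) (free_deriv K g) p \<noteq> \<zero>\<^bsub>K\<^esub>} \<subseteq> Collect proper_mono" by (rule 2)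
  qed
qed

text \<open>The factorization through F: the value at \<open>v\<close> is the image of the value at
  the generators. The support condition is carried along because \<open>realize_mult\<close>
  requires it.\<close>

lemma eval_term_realize:
  assumes "term_coeffs t \<subseteq> carrier K"
  defines "E \<equiv> eval_term (deriv_algebra (free_perm K) (free_deriv K)) (generator K) t"
  shows "E \<in> carrier (free_perm K) \<and> {m. E m \<noteq> \<zero>\<^bsub>K\<^esub>} \<subseteq> Collect proper_mono \<and> eval_term A v t = realize E"
  using assms(1) unfolding E_def
proof (induction t)
  case (TVar i)
  have "{m. generator K i m \<noteq> \<zero>\<^bsub>K\<^esub>} \<subseteq> Collect proper_mono"
    by (auto simp: generator_def single_def proper_mono_def proper_def)
  then show ?case by (simp add: generator_def realize_single mono_val_def)
next
  case TZero
  interpret F: module K "free_perm K" by (rule K.module_free_perm)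
  have "realize \<zero>\<^bsub>free_perm K\<^esub> = \<zero>\<^bsub>A\<^esub>"
    by (rule linear_on_zero[OF K.module_free_perm A.module_axioms linear_realize])
  then show ?case by (simp, simp add: free_perm_def free_module_simps)
next
  case (TAdd s t)
  interpret F: module K "free_perm K" by (rule K.module_free_perm)
  let ?E = "eval_term (deriv_algebra (free_perm K) (free_deriv K)) (generator K)"
  have "{m. (?E s \<oplus>\<^bsub>free_perm K\<^esub> ?E t) m \<noteq> \<zero>\<^bsub>K\<^esub>} \<subseteq> {m. ?E s m \<noteq> \<zero>\<^bsub>K\<^esub>} \<union> {m. ?E t m \<noteq> \<zero>\<^bsub>K\<^esub>}"
    by (auto simp: free_perm_def free_module_simps)
  then show ?case using TAdd by (auto simp: linear_onD(2)[OF linear_realize])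
next
  case (TSmult c t)
  interpret F: module K "free_perm K" by (rule K.module_free_perm)
  let ?E = "eval_term (deriv_algebra (free_perm K) (free_deriv K)) (generator K)"
  have "{m. (c \<odot>\<^bsub>free_perm K\<^esub> ?E t) m \<noteq> \<zero>\<^bsub>K\<^esub>} \<subseteq> {m. ?E t m \<noteq> \<zero>\<^bsub>K\<^esub>}"
    using TSmult by (auto simp: free_perm_def free_module_simps)
  then show ?case using TSmult by (auto simp: linear_onD(3)[OF linear_realize])
next
  case (TMult s t)
  then show ?case
    using realize_mult linear_onD(1)[OF K.linear_free_deriv] by (simp add: free_perm_mult)
qed

end

end

section \<open>Special algebras and varieties\<close>

lemma Perm_algebraD:
  assumes "Perm_algebra K P" "x \<in> carrier P" "y \<in> carrier P" "z \<in> carrier P"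
  shows "(x \<otimes>\<^bsub>P\<^esub> y) \<otimes>\<^bsub>P\<^esub> z = x \<otimes>\<^bsub>P\<^esub> (y \<otimes>\<^bsub>P\<^esub> z)"
    and "x \<otimes>\<^bsub>P\<^esub> (y \<otimes>\<^bsub>P\<^esub> z) = y \<otimes>\<^bsub>P\<^esub> (x \<otimes>\<^bsub>P\<^esub> z)"
  using assms by (metis Perm_algebra_def)+

lemma module_cong:
  assumes "module K A" "carrier B = carrier A" "ring.zero B = ring.zero A" "ring.add B = ring.add A" "smult B = smult A"
  shows "module K B"
proof -
  interpret A: module K A by fact
  show ?thesis
    by (rule moduleI, rule A.is_cring, rule abelian_groupI)
      (auto simp: assms A.M.a_ac A.smult_l_distr A.smult_r_distr A.smult_assoc1
        intro: bexI[of _ "\<ominus>\<^bsub>A\<^esub> _"] A.M.l_neg)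
qed

text \<open>For the product x d(y) the associator is (x,y,z) = - x y d(d(z)), symmetric in x and y
  by the Perm law, and likewise (x, y d(z), u) = - x y d(z) d(d(u)). The remaining identity holds
  because d(y) and d(z) commute in front of d(u).\<close>

lemma SLS_deriv_algebra:
  assumes "differential_Perm_algebra K P d"
  shows "SLS_algebra K (deriv_algebra P d)"
proof -
  have P: "Perm_algebra K P" and d: "derivation K P d"
    using assms by (auto simp: differential_Perm_algebra_def)
  then have na: "nonassoc_algebra K P" and lin: "linear_on K P P d"
    by (auto simp: Perm_algebra_def derivation_def)
  interpret P: module K P by (rule nonassoc_algebraD(1)[OF na])
  note [simp] = nonassoc_algebraD(2-)[OF na] linear_onD[OF lin]
  have [simp]: "d (x \<otimes>\<^bsub>P\<^esub> y) = (d x \<otimes>\<^bsub>P\<^esub> y) \<oplus>\<^bsub>P\<^esub> (x \<otimes>\<^bsub>P\<^esub> d y)"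
    if "x \<in> carrier P" "y \<in> carrier P" for x y
    using d that by (simp add: derivation_def)
  note ac = Perm_algebraD[OF P] P.M.a_ac
  have "module K (deriv_algebra P d)"
    by (rule module_cong[OF P.module_axioms]) (simp_all add: deriv_algebra_def)
  then have "nonassoc_algebra K (deriv_algebra P d)"
    by (simp add: nonassoc_algebra_def linear_on_def)
  then show ?thesis
    by (simp add: SLS_algebra_iff ac)
qed

lemma special_deriv_algebra:
  assumes "differential_Perm_algebra K P d"
  shows "special K (deriv_algebra P d)"
  unfolding special_def
proof (intro conjI exI)
  show "left_symmetric_algebra K (deriv_algebra P d)"
    using SLS_deriv_algebra[OF assms] by (simp add: SLS_algebra_def)
  show "differential_Perm_algebra K P d" by fact
  show "linear_on K (deriv_algebra P d) P (\<lambda>x. x)"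
    by (simp add: linear_on_def)
qed simp_all

text \<open>The embedding is an injective homomorphism into \<open>deriv_algebra P d\<close>, along
  which the identities are pulled back.\<close>

lemma special_imp_SLS:
  fixes K :: "('k, 'm) ring_scheme" and A :: "('k, 'u) module"
  assumes "special K A"
  shows "SLS_algebra K A"
proof -
  obtain P :: "('k, 'u) module" and d \<theta> where P: "differential_Perm_algebra K P d"
    and \<theta>: "linear_on K A P \<theta>" "inj_on \<theta> (carrier A)"
    and mult: "\<And>a b. a \<in> carrier A \<Longrightarrow> b \<in> carrier A \<Longrightarrow> \<theta> (a \<otimes>\<^bsub>A\<^esub> b) = \<theta> a \<otimes>\<^bsub>P\<^esub> d (\<theta> b)"
    using assms by (auto simp: special_def)
  have na: "nonassoc_algebra K A"
    using assms by (simp add: special_def left_symmetric_algebra_def)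
  interpret A: module K A by (rule nonassoc_algebraD(1)[OF na])
  have cl: "a \<otimes>\<^bsub>A\<^esub> b \<in> carrier A" if "a \<in> carrier A" "b \<in> carrier A" for a b
    by (rule nonassoc_algebraD(2)[OF na that])
  have inj: "a = b" if "\<theta> a = \<theta> b" "a \<in> carrier A" "b \<in> carrier A" for a b
    using \<theta>(2) that by (rule inj_onD)
  let ?Q = "deriv_algebra P d"
  have "\<theta> a \<in> carrier ?Q" if "a \<in> carrier A" for a
    using linear_onD(1)[OF \<theta>(1) that] by simp
  moreover have "\<theta> (a \<oplus>\<^bsub>A\<^esub> b) = \<theta> a \<oplus>\<^bsub>?Q\<^esub> \<theta> b" "\<theta> (a \<otimes>\<^bsub>A\<^esub> b) = \<theta> a \<otimes>\<^bsub>?Q\<^esub> \<theta> b"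
    if "a \<in> carrier A" "b \<in> carrier A" for a b
    using that by (simp_all add: mult linear_onD(2)[OF \<theta>(1)])
  ultimately have hom: "\<And>a. a \<in> carrier A \<Longrightarrow> \<theta> a \<in> carrier ?Q"
    "\<And>a b. a \<in> carrier A \<Longrightarrow> b \<in> carrier A \<Longrightarrow> \<theta> (a \<oplus>\<^bsub>A\<^esub> b) = \<theta> a \<oplus>\<^bsub>?Q\<^esub> \<theta> b"
    "\<And>a b. a \<in> carrier A \<Longrightarrow> b \<in> carrier A \<Longrightarrow> \<theta> (a \<otimes>\<^bsub>A\<^esub> b) = \<theta> a \<otimes>\<^bsub>?Q\<^esub> \<theta> b"
    by auto
  note Q = SLS_deriv_algebra[OF P, unfolded SLS_algebra_iff]
  show ?thesis
    unfolding SLS_algebra_iff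
  proof (intro conjI na ballI)
    fix x y z assume xyz: "x \<in> carrier A" "y \<in> carrier A" "z \<in> carrier A"
    show "x \<otimes>\<^bsub>A\<^esub> y \<otimes>\<^bsub>A\<^esub> z \<oplus>\<^bsub>A\<^esub> y \<otimes>\<^bsub>A\<^esub> (x \<otimes>\<^bsub>A\<^esub> z) = y \<otimes>\<^bsub>A\<^esub> x \<otimes>\<^bsub>A\<^esub> z \<oplus>\<^bsub>A\<^esub> x \<otimes>\<^bsub>A\<^esub> (y \<otimes>\<^bsub>A\<^esub> z)"
      by (rule inj) (use Q xyz in \<open>simp_all add: cl hom del: deriv_algebra_simps\<close>)
    fix u assume u: "u \<in> carrier A"
    show "x \<otimes>\<^bsub>A\<^esub> y \<otimes>\<^bsub>A\<^esub> z \<otimes>\<^bsub>A\<^esub> u = x \<otimes>\<^bsub>A\<^esub> z \<otimes>\<^bsub>A\<^esub> y \<otimes>\<^bsub>A\<^esub> u"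
      by (rule inj) (use Q xyz u in \<open>simp_all add: cl hom del: deriv_algebra_simps\<close>)
    show "x \<otimes>\<^bsub>A\<^esub> (y \<otimes>\<^bsub>A\<^esub> z) \<otimes>\<^bsub>A\<^esub> u \<oplus>\<^bsub>A\<^esub> y \<otimes>\<^bsub>A\<^esub> (x \<otimes>\<^bsub>A\<^esub> z \<otimes>\<^bsub>A\<^esub> u) =
        y \<otimes>\<^bsub>A\<^esub> (x \<otimes>\<^bsub>A\<^esub> z) \<otimes>\<^bsub>A\<^esub> u \<oplus>\<^bsub>A\<^esub> x \<otimes>\<^bsub>A\<^esub> (y \<otimes>\<^bsub>A\<^esub> z \<otimes>\<^bsub>A\<^esub> u)"
      by (rule inj) (use Q xyz u in \<open>simp_all add: cl hom del: deriv_algebra_simps\<close>)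
  qed
qed

definition SLS_identities :: "('k, 'm) ring_scheme \<Rightarrow> ('k alg_term \<times> 'k alg_term) set" where
  "SLS_identities K = (let x = TVar 0; y = TVar 1; z = TVar 2; u = TVar 3 in
     {(TAdd (TMult (TMult x y) z) (TMult y (TMult x z)), TAdd (TMult (TMult y x) z) (TMult x (TMult y z))),
      (TMult (TMult (TMult x y) z) u, TMult (TMult (TMult x z) y) u),
      (TAdd (TMult (TMult x (TMult y z)) u) (TMult y (TMult (TMult x z) u)),
       TAdd (TMult (TMult y (TMult x z)) u) (TMult x (TMult (TMult y z) u)))})"

lemma is_variety_SLS:
  fixes K :: "('k, 'm) ring_scheme"
  shows "is_variety K (SLS_algebras K :: ('k, 'u) module set)"
proof -
  have "(\<forall>e\<in>SLS_identities K. satisfies A e) \<longleftrightarrow> SLS_algebra K A"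
    if A: "nonassoc_algebra K A" for A :: "('k, 'u) module"
  proof
    assume sat: "\<forall>e\<in>SLS_identities K. satisfies A e"
    have ev: "eval_term A (\<lambda>n. if n = 0 then x else if n = 1 then y else if n = 2 then z else u) s =
        eval_term A (\<lambda>n. if n = 0 then x else if n = 1 then y else if n = 2 then z else u) t"
      if "(s, t) \<in> SLS_identities K" "x \<in> carrier A" "y \<in> carrier A" "z \<in> carrier A" "u \<in> carrier A"
      for s t x y z u
    proof -
      have "range (\<lambda>n. if n = 0 then x else if n = 1 then y else if n = (2::nat) then z else u) \<subseteq> carrier A"
        using that by auto
      then show ?thesis using sat that(1) unfolding satisfies_def by fastforce
    qed
    show "SLS_algebra K A"
      unfolding SLS_algebra_iff
    proof (intro conjI ballI A)
      fix x y z assume xyz: "x \<in> carrier A" "y \<in> carrier A" "z \<in> carrier A"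
      show "x \<otimes>\<^bsub>A\<^esub> y \<otimes>\<^bsub>A\<^esub> z \<oplus>\<^bsub>A\<^esub> y \<otimes>\<^bsub>A\<^esub> (x \<otimes>\<^bsub>A\<^esub> z) = y \<otimes>\<^bsub>A\<^esub> x \<otimes>\<^bsub>A\<^esub> z \<oplus>\<^bsub>A\<^esub> x \<otimes>\<^bsub>A\<^esub> (y \<otimes>\<^bsub>A\<^esub> z)"
        using ev[OF _ xyz xyz(1), of "TAdd (TMult (TMult (TVar 0) (TVar 1)) (TVar 2)) (TMult (TVar 1) (TMult (TVar 0) (TVar 2)))"
            "TAdd (TMult (TMult (TVar 1) (TVar 0)) (TVar 2)) (TMult (TVar 0) (TMult (TVar 1) (TVar 2)))"]
        by (simp add: SLS_identities_def Let_def)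
      fix u assume u: "u \<in> carrier A"
      show "x \<otimes>\<^bsub>A\<^esub> y \<otimes>\<^bsub>A\<^esub> z \<otimes>\<^bsub>A\<^esub> u = x \<otimes>\<^bsub>A\<^esub> z \<otimes>\<^bsub>A\<^esub> y \<otimes>\<^bsub>A\<^esub> u"
        using ev[OF _ xyz u, of "TMult (TMult (TMult (TVar 0) (TVar 1)) (TVar 2)) (TVar 3)"
            "TMult (TMult (TMult (TVar 0) (TVar 2)) (TVar 1)) (TVar 3)"]
        by (simp add: SLS_identities_def Let_def)
      show "x \<otimes>\<^bsub>A\<^esub> (y \<otimes>\<^bsub>A\<^esub> z) \<otimes>\<^bsub>A\<^esub> u \<oplus>\<^bsub>A\<^esub> y \<otimes>\<^bsub>A\<^esub> (x \<otimes>\<^bsub>A\<^esub> z \<otimes>\<^bsub>A\<^esub> u) =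
          y \<otimes>\<^bsub>A\<^esub> (x \<otimes>\<^bsub>A\<^esub> z) \<otimes>\<^bsub>A\<^esub> u \<oplus>\<^bsub>A\<^esub> x \<otimes>\<^bsub>A\<^esub> (y \<otimes>\<^bsub>A\<^esub> z \<otimes>\<^bsub>A\<^esub> u)"
        using ev[OF _ xyz u, of
            "TAdd (TMult (TMult (TVar 0) (TMult (TVar 1) (TVar 2))) (TVar 3)) (TMult (TVar 1) (TMult (TMult (TVar 0) (TVar 2)) (TVar 3)))"
            "TAdd (TMult (TMult (TVar 1) (TMult (TVar 0) (TVar 2))) (TVar 3)) (TMult (TVar 0) (TMult (TMult (TVar 1) (TVar 2)) (TVar 3)))"]
        by (simp add: SLS_identities_def Let_def)
    qed
  next
    assume SLS: "SLS_algebra K A"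
    show "\<forall>e\<in>SLS_identities K. satisfies A e"
    proof (intro ballI, unfold satisfies_def, intro allI impI)
      fix e and v :: "nat \<Rightarrow> 'u" assume e: "e \<in> SLS_identities K" and "range v \<subseteq> carrier A"
      then have "v n \<in> carrier A" for n by auto
      then show "eval_term A v (fst e) = eval_term A v (snd e)"
        using SLS e by (auto simp: SLS_identities_def SLS_algebra_iff Let_def)
    qed
  qed
  moreover have "nonassoc_algebra K A" if "SLS_algebra K A" for A :: "('k, 'u) module"
    using that by (simp add: SLS_algebra_iff)
  ultimately have "(SLS_algebras K :: ('k, 'u) module set) = variety K (SLS_identities K)"
    unfolding SLS_algebras_def variety_def by blast
  moreover have "SLS_identities K \<subseteq> identities K"
    by (auto simp: SLS_identities_def identities_def Let_def)
  ultimately show ?thesis unfolding is_variety_def by blast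
qed

text \<open>Copies an algebra along an injection, here from the type of functions carrying F into
  the universe \<open>'u\<close>.\<close>

definition transport :: "('b \<Rightarrow> 'u) \<Rightarrow> ('k, 'b) module \<Rightarrow> ('k, 'u) module" where
  "transport g A = (let h = inv_into (carrier A) g in
     \<lparr>carrier = g ` carrier A, monoid.mult = (\<lambda>x y. g (h x \<otimes>\<^bsub>A\<^esub> h y)), one = undefined,
      ring.zero = g \<zero>\<^bsub>A\<^esub>, ring.add = (\<lambda>x y. g (h x \<oplus>\<^bsub>A\<^esub> h y)), smult = (\<lambda>c x. g (c \<odot>\<^bsub>A\<^esub> h x))\<rparr>)"

context
  fixes g :: "'b \<Rightarrow> 'u" and A :: "('k, 'b) module"
  assumes g: "inj_on g (carrier A)"
begin

lemma transport_simps [simp]: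
  "carrier (transport g A) = g ` carrier A"
  "\<zero>\<^bsub>transport g A\<^esub> = g \<zero>\<^bsub>A\<^esub>"
  "x \<in> carrier A \<Longrightarrow> y \<in> carrier A \<Longrightarrow> g x \<otimes>\<^bsub>transport g A\<^esub> g y = g (x \<otimes>\<^bsub>A\<^esub> y)"
  "x \<in> carrier A \<Longrightarrow> y \<in> carrier A \<Longrightarrow> g x \<oplus>\<^bsub>transport g A\<^esub> g y = g (x \<oplus>\<^bsub>A\<^esub> y)"
  "x \<in> carrier A \<Longrightarrow> c \<odot>\<^bsub>transport g A\<^esub> g x = g (c \<odot>\<^bsub>A\<^esub> x)"
  by (simp_all add: transport_def Let_def inv_into_f_f[OF g])

lemma module_transport:
  assumes "module K A"
  shows "module K (transport g A)"
proof -
  interpret A: module K A by fact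
  show ?thesis
  proof (rule moduleI, rule A.is_cring, rule abelian_groupI)
    fix x assume "x \<in> carrier (transport g A)"
    then obtain a where a: "a \<in> carrier A" "x = g a" by auto
    show "\<exists>y\<in>carrier (transport g A). y \<oplus>\<^bsub>transport g A\<^esub> x = \<zero>\<^bsub>transport g A\<^esub>"
      using a by (intro bexI[of _ "g (\<ominus>\<^bsub>A\<^esub> a)"]) (simp_all add: A.M.l_neg)
  qed (auto simp: A.M.a_ac A.smult_l_distr A.smult_r_distr A.smult_assoc1)
qed

lemma nonassoc_algebra_transport:
  assumes A: "nonassoc_algebra K A"
  shows "nonassoc_algebra K (transport g A)"
proof -
  interpret A: module K A by (rule nonassoc_algebraD(1)[OF A])
  show ?thesis
    unfolding nonassoc_algebra_def linear_on_def
    by (auto simp: module_transport A.module_axioms nonassoc_algebraD(2-)[OF A])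
qed

lemma differential_Perm_algebra_transport:
  assumes "differential_Perm_algebra K A d"
  shows "differential_Perm_algebra K (transport g A) (\<lambda>x. g (d (inv_into (carrier A) g x)))"
proof -
  have P: "Perm_algebra K A" and d: "derivation K A d"
    using assms by (auto simp: differential_Perm_algebra_def)
  then have na: "nonassoc_algebra K A" and lin: "linear_on K A A d"
    by (auto simp: Perm_algebra_def derivation_def)
  interpret A: module K A by (rule nonassoc_algebraD(1)[OF na])
  note [simp] = nonassoc_algebraD(2)[OF na] linear_onD[OF lin] inv_into_f_f[OF g]
  have "Perm_algebra K (transport g A)"
    using nonassoc_algebra_transport[OF na] by (auto simp: Perm_algebra_def Perm_algebraD[OF P])
  moreover have "derivation K (transport g A) (\<lambda>x. g (d (inv_into (carrier A) g x)))"
    using d by (auto simp: derivation_def linear_on_def)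
  ultimately show ?thesis by (simp add: differential_Perm_algebra_def)
qed

lemma eval_term_transport:
  assumes "differential_Perm_algebra K A d" "range w \<subseteq> carrier A" "term_coeffs t \<subseteq> carrier K"
  shows "eval_term (deriv_algebra A d) w t \<in> carrier A \<and>
    eval_term (deriv_algebra (transport g A) (\<lambda>x. g (d (inv_into (carrier A) g x)))) (\<lambda>i. g (w i)) t =
    g (eval_term (deriv_algebra A d) w t)"
  using assms(3)
proof (induction t)
  have na: "nonassoc_algebra K A" and lin: "linear_on K A A d"
    using assms(1) by (auto simp: differential_Perm_algebra_def Perm_algebra_def derivation_def)
  interpret A: module K A by (rule nonassoc_algebraD(1)[OF na])
  note [simp] = nonassoc_algebraD(2)[OF na] linear_onD(1)[OF lin] inv_into_f_f[OF g]
  {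
    case (TVar i)
    then show ?case using assms(2) by auto
  next
    case TZero
    then show ?case by simp
  next
    case (TAdd s t)
    then show ?case by simp
  next
    case (TSmult c t)
    then show ?case by simp
  next
    case (TMult s t)
    then show ?case by simp
  }
qed

end

lemma multiset_lepoll_nat: "(UNIV :: 'a::countable multiset set) \<lesssim> (UNIV :: nat set)"
proof -
  have "inj (\<lambda>M :: 'a multiset. SOME xs. mset xs = M)"
    by (rule inj_on_inverseI[of _ mset]) (rule someI_ex, rule ex_mset)
  then have "inj (\<lambda>M :: 'a multiset. to_nat (SOME xs. mset xs = M))"
    by (rule inj_compose[OF inj_to_nat, unfolded comp_def])
  then show ?thesis unfolding lepoll_def by blast
qed

text \<open>A finitely supported function is determined by its graph over the support, a finite set
  of pairs. Monomials are countable, so the pairs embed in \<open>'u\<close>, and an infinite set is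
  equipotent with the set of its finite subsets.\<close>

lemma free_perm_lepoll:
  fixes K :: "('k, 'm) ring_scheme"
  assumes inf: "infinite (UNIV :: 'u set)" and K: "carrier K \<lesssim> (UNIV :: 'u set)"
  shows "carrier (free_perm K) \<lesssim> (UNIV :: 'u set)"
proof -
  have times: "(UNIV :: 'u set) \<times> (UNIV :: 'u set) \<lesssim> (UNIV :: 'u set)"
    using card_of_Times_same_infinite[OF inf]
    by (meson card_of_ordLeq lepoll_def ordIso_imp_ordLeq)
  have nat: "(UNIV :: nat set) \<lesssim> (UNIV :: 'u set)"
    using inf infinite_le_lepoll by blast
  have "(UNIV :: monomial set) \<lesssim> (UNIV :: nat set) \<times> (UNIV :: nat set)"
  proof -
    have "(UNIV :: (nat \<times> nat) set) \<lesssim> (UNIV :: nat set)"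
      unfolding lepoll_def using inj_to_nat by blast
    then show ?thesis
      using times_lepoll_mono[OF multiset_lepoll_nat, of "UNIV :: (nat \<times> nat) set" "UNIV :: nat set"] by simp
  qed
  also have "\<dots> \<lesssim> (UNIV :: 'u set) \<times> (UNIV :: 'u set)"
    using nat nat by (rule times_lepoll_mono)
  also have "\<dots> \<lesssim> (UNIV :: 'u set)" by (rule times)
  finally have mono: "(UNIV :: monomial set) \<lesssim> (UNIV :: 'u set)" .
  have "(UNIV :: monomial set) \<times> carrier K \<lesssim> (UNIV :: 'u set)"
    using times_lepoll_mono[OF mono K] times lepoll_trans by blast
  then obtain e :: "monomial \<times> 'k \<Rightarrow> 'u" where e: "inj_on e (UNIV \<times> carrier K)"
    unfolding lepoll_def by blast
  define code where "code f = e ` {(m, f m) | m. f m \<noteq> \<zero>\<^bsub>K\<^esub>}" for f :: "monomial \<Rightarrow> 'k"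
  have "inj_on code (carrier (free_perm K))"
  proof (rule inj_onI)
    fix f h assume f: "f \<in> carrier (free_perm K)" and h: "h \<in> carrier (free_perm K)" and eq: "code f = code h"
    have graph: "{(m, f m) | m. f m \<noteq> \<zero>\<^bsub>K\<^esub>} = {(m, h m) | m. h m \<noteq> \<zero>\<^bsub>K\<^esub>}"
      using eq f h unfolding code_def
      by (subst (asm) inj_on_image_eq_iff[OF e]) (auto simp: free_perm_def free_module_carrier)
    have "(x = f m \<and> f m \<noteq> \<zero>\<^bsub>K\<^esub>) = (x = h m \<and> h m \<noteq> \<zero>\<^bsub>K\<^esub>)" for m x
      using arg_cong[OF graph, of "\<lambda>S. (m, x) \<in> S"] by (cases m) simp
    then have "f m = h m" for m by metis
    then show "f = h" by auto
  qed
  moreover have "code f \<in> Fpow UNIV" if "f \<in> carrier (free_perm K)" for f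
  proof -
    have "{(m, f m) | m. f m \<noteq> \<zero>\<^bsub>K\<^esub>} = (\<lambda>m. (m, f m)) ` {m. f m \<noteq> \<zero>\<^bsub>K\<^esub>}" by auto
    then show ?thesis using that by (simp add: code_def Fpow_def free_perm_def free_module_carrier)
  qed
  ultimately have "carrier (free_perm K) \<lesssim> Fpow (UNIV :: 'u set)"
    unfolding lepoll_def by blast
  then show ?thesis
    using eqpoll_Fpow[OF inf] by (meson eqpoll_imp_lepoll lepoll_trans)
qed

theorem corollary5:
  fixes K :: "('k, 'm) ring_scheme"
  assumes "field K"
    and "infinite (UNIV :: 'u set)"
    and "carrier K \<lesssim> (UNIV :: 'u set)"
  shows "smallest_variety_containing K
    (special_algebras K :: ('k, 'u) module set) (SLS_algebras K)"
  unfolding smallest_variety_containing_def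
proof (intro conjI allI impI)
  show "is_variety K (SLS_algebras K :: ('k, 'u) module set)"
    by (rule is_variety_SLS)
  show "(special_algebras K :: ('k, 'u) module set) \<subseteq> SLS_algebras K"
    by (auto simp: special_algebras_def SLS_algebras_def special_imp_SLS)
next
  fix W :: "('k, 'u) module set"
  assume W: "is_variety K W \<and> special_algebras K \<subseteq> W"
  then obtain E where E: "E \<subseteq> identities K" "W = variety K E"
    by (auto simp: is_variety_def)
  obtain g :: "(monomial \<Rightarrow> 'k) \<Rightarrow> 'u" where g: "inj_on g (carrier (free_perm K))"
    using free_perm_lepoll[OF assms(2,3)] by (auto simp: lepoll_def)
  interpret K: field K by fact
  let ?d = "\<lambda>x. g (free_deriv K (inv_into (carrier (free_perm K)) g x))"
  let ?B = "deriv_algebra (transport g (free_perm K)) ?d"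
  \<comment> \<open>\<open>?B\<close> is F with the product a d(b), copied into \<open>'u\<close>;
    being special, it lies in \<open>W\<close> and so satisfies \<open>E\<close>.\<close>
  have "special K ?B"
    by (intro special_deriv_algebra differential_Perm_algebra_transport g K.differential_Perm_algebra_free)
  then have B: "?B \<in> variety K E"
    using W E by (auto simp: special_algebras_def)
  have gen: "range (generator K) \<subseteq> carrier (free_perm K)"
    by (auto simp: generator_def)
  show "SLS_algebras K \<subseteq> W"
  proof
    fix A :: "('k, 'u) module" assume "A \<in> SLS_algebras K"
    then have A: "SLS_algebra K A" by (simp add: SLS_algebras_def)
    have "satisfies A e" if e: "e \<in> E" for e
      unfolding satisfies_def
    proof (intro allI impI)
      fix v :: "nat \<Rightarrow> 'u" assume "range v \<subseteq> carrier A"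
      then interpret sls_valuation K A v using A by unfold_locales
      obtain s t where st: "e = (s, t)" by fastforce
      have coeffs: "term_coeffs s \<subseteq> carrier K" "term_coeffs t \<subseteq> carrier K"
        using E(1) e by (auto simp: identities_def st)
      note tr = eval_term_transport[OF g K.differential_Perm_algebra_free gen]
      have "range (\<lambda>i. g (generator K i)) \<subseteq> carrier ?B"
        using gen g by auto
      \<comment> \<open>The identity is used at the images of the generators; injectivity of
        \<open>g\<close> brings it back to F, and \<open>eval_term_realize\<close> sends it on to
        A.\<close>
      then have "eval_term ?B (\<lambda>i. g (generator K i)) s = eval_term ?B (\<lambda>i. g (generator K i)) t"
        using B e by (auto simp: variety_def satisfies_def st)
      then have "eval_term (deriv_algebra (free_perm K) (free_deriv K)) (generator K) s =
          eval_term (deriv_algebra (free_perm K) (free_deriv K)) (generator K) t"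
        using tr[OF coeffs(1)] tr[OF coeffs(2)] inj_onD[OF g] by auto
      then show "eval_term A v (fst e) = eval_term A v (snd e)"
        using eval_term_realize[OF assms(1)] coeffs by (simp add: st)
    qed
    then show "A \<in> W"
      using A by (simp add: E(2) variety_def SLS_algebra_iff)
  qed
qed

end
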